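(* Let $G$ be a finite group and $H\le G$ a subgroup, endowed with supercharacter theories $(\mathrm{scl}(G),\mathrm{sch}(G))$ and $(\mathrm{scl}(H),\mathrm{sch}(H))$ such that the theory of $H$ is consistent with that of $G$. Then: 1. For each $\chi\in\mathrm{sch}(G)$, $\sum_{\gamma\in\mathrm{sch}(H)}\rho_H^G(\gamma,\chi)\,\mathrm{SPl}_H(\gamma)=\mathrm{SPl}_G(\chi)$. 2. For each $\gamma\in\mathrm{sch}(H)$, $\sum_{\chi\in\mathrm{sch}(G)}\rho_H^G(\gamma,\chi)=1$. In particular, let $\{1\}=G_0\hookrightarrow G_1\hookrightarrow\cdots\hookrightarrow G_n\hookrightarrow G_{n+1}\hookrightarrow\cdots$ be a tower of finite groups, and suppose that to each $G_n$ is associated a supercharacter theory $T_n$ such that $T_n$ is consistent with $T_{n+1}$ for every $n$. Let $\chi_1$ be the unique supercharacter of $G_0=\{1\}$. Then the Markov process with initial state $\chi_1$ and transition measures $\rho_{G_n}^{G_{n+1}}$ (from $\mathrm{sch}(G_n)$ to $\mathrm{sch}(G_{n+1})$) has $n$-th marginal distributed as $\mathrm{SPl}_{G_n}$ for every $n$.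
   Context: A supercharacter theory of a finite group $G$ is a pair $(\mathrm{scl}(G),\mathrm{sch}(G))$ where $\mathrm{scl}(G)$ is a set partition of $G$ and $\mathrm{sch}(G)$ is an orthogonal set of nonzero complex characters of $G$ (not necessarily irreducible) such that: (1) $|\mathrm{scl}(G)|=|\mathrm{sch}(G)|$; (2) every $\chi\in\mathrm{sch}(G)$ is constant on each $\mathcal K\in\mathrm{scl}(G)$; (3) each irreducible character of $G$ is a constituent of one, and only one, $\chi\in\mathrm{sch}(G)$. Elements of $\mathrm{scl}(G)$ are superclasses, elements of $\mathrm{sch}(G)$ supercharacters. The scalar product is $\langle\chi,\zeta\rangle=\frac1{|G|}\sum_{g\in G}\chi(g)\overline{\zeta(g)}$. The superplancherel measure is $\mathrm{SPl}_G(\chi)=\frac{1}{|G|}\frac{\chi(1)^2}{\langle\chi,\chi\rangle}$ for $\chi\in\mathrm{sch}(G)$. Superinduction: for $\phi:H\to\mathbb C$ let $\phi^0:G\to\mathbb C$ equal $\phi$ on $H$ and $0$ outside $H$; put $\mathrm{SInd}_H^G(\phi)(g)=\frac{|G|}{|H|\cdot|[g]|}\sum_{k\in[g]}\phi^0(k)$, where $[g]\in\mathrm{scl}(G)$ is the superclass containing $g$. The theory of $H$ is consistent with that of $G$ if for each $\mathcal H\in\mathrm{scl}(H)$ there is $\mathcal K\in\mathrm{scl}(G)$ with $\mathcal H\subseteq\mathcal K$. Transition measure: for $\gamma\in\mathrm{sch}(H)$, $\chi\in\mathrm{sch}(G)$, $$\rho_H^G(\gamma,\chi)=\frac{|H|}{|G|}\,\frac{\chi(1)}{\gamma(1)}\,\frac{\langle\mathrm{SInd}_H^G(\gamma),\chi\rangle}{\langle\chi,\chi\rangle}.$$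 *)

theory Defs
  imports
    "HOL-Algebra.Coset"
    "HOL-Probability.Probability"
    "HOL-Library.Disjoint_Sets"
    "Jordan_Normal_Form.Matrix"
    "Jordan_Normal_Form.VS_Connect"
begin

section \<open>Complex characters of a group\<close>

definition is_rep :: "('a, 'c) monoid_scheme \<Rightarrow> nat \<Rightarrow> ('a \<Rightarrow> complex mat) \<Rightarrow> bool" where
  "is_rep G n R \<longleftrightarrow>
     (\<forall>g\<in>carrier G. R g \<in> carrier_mat n n) \<and>
     R \<one>\<^bsub>G\<^esub> = 1\<^sub>m n \<and>
     (\<forall>g\<in>carrier G. \<forall>h\<in>carrier G. R (g \<otimes>\<^bsub>G\<^esub> h) = R g * R h)"

definition irreducible_rep :: "('a, 'c) monoid_scheme \<Rightarrow> nat \<Rightarrow> ('a \<Rightarrow> complex mat) \<Rightarrow> bool" where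
  "irreducible_rep G n R \<longleftrightarrow> is_rep G n R \<and> n > 0 \<and>
     (\<forall>W. VectorSpace.subspace class_ring W (module_vec TYPE(complex) n) \<and>
          (\<forall>g\<in>carrier G. \<forall>w\<in>W. R g *\<^sub>v w \<in> W) \<longrightarrow>
          W = {0\<^sub>v n} \<or> W = carrier_vec n)"

text \<open>Functions on a subset of a type are represented by total functions that vanish
  outside that subset, so that equality of characters and cardinality of sets of characters
  have their usual meaning.\<close>

definition affords :: "('a, 'c) monoid_scheme \<Rightarrow> nat \<Rightarrow> ('a \<Rightarrow> complex mat) \<Rightarrow> ('a \<Rightarrow> complex) \<Rightarrow> bool" where
  "affords G n R chi \<longleftrightarrow>
     (\<forall>g. chi g = (if g \<in> carrier G then (\<Sum>i<n. R g $$ (i, i)) else 0))"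

text \<open>Degree 0 is allowed here: the zero function is the character of the zero
  representation.\<close>

definition is_character :: "('a, 'c) monoid_scheme \<Rightarrow> ('a \<Rightarrow> complex) \<Rightarrow> bool" where
  "is_character G chi \<longleftrightarrow> (\<exists>n R. is_rep G n R \<and> affords G n R chi)"

definition irreducible_character :: "('a, 'c) monoid_scheme \<Rightarrow> ('a \<Rightarrow> complex) \<Rightarrow> bool" where
  "irreducible_character G \<psi> \<longleftrightarrow> (\<exists>n R. irreducible_rep G n R \<and> affords G n R \<psi>)"

text \<open>An irreducible \<open>\<psi>\<close> is a constituent of \<open>chi\<close> if it occurs in a decomposition of \<open>chi\<close> as a sum of
  characters; the complement may be the zero character.\<close>

definition constituent :: "('a, 'c) monoid_scheme \<Rightarrow> ('a \<Rightarrow> complex) \<Rightarrow> ('a \<Rightarrow> complex) \<Rightarrow> bool" where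
  "constituent G \<psi> chi \<longleftrightarrow> irreducible_character G \<psi> \<and>
     (\<exists>\<theta>. is_character G \<theta> \<and> (\<forall>g. chi g = \<psi> g + \<theta> g))"

definition char_inner :: "('a, 'c) monoid_scheme \<Rightarrow> ('a \<Rightarrow> complex) \<Rightarrow> ('a \<Rightarrow> complex) \<Rightarrow> complex" where
  "char_inner G chi \<zeta> = 1 / of_nat (card (carrier G)) * (\<Sum>g\<in>carrier G. chi g * cnj (\<zeta> g))"


section \<open>Supercharacter theories\<close>

text \<open>A pair consisting of a set of superclasses and a set of supercharacters.\<close>

type_synonym 'a sct = "'a set set \<times> ('a \<Rightarrow> complex) set"

abbreviation scl :: "'a sct \<Rightarrow> 'a set set" where "scl \<equiv> fst"
abbreviation sch :: "'a sct \<Rightarrow> ('a \<Rightarrow> complex) set" where "sch \<equiv> snd"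

definition supercharacter_theory :: "('a, 'c) monoid_scheme \<Rightarrow> 'a sct \<Rightarrow> bool" where
  "supercharacter_theory G T \<longleftrightarrow>
     partition_on (carrier G) (scl T) \<and>
     (\<forall>chi\<in>sch T. is_character G chi \<and> chi \<noteq> (\<lambda>_. 0)) \<and>
     pairwise (\<lambda>chi \<zeta>. char_inner G chi \<zeta> = 0) (sch T) \<and>
     finite (sch T) \<and> card (scl T) = card (sch T) \<and>
     (\<forall>chi\<in>sch T. \<forall>K\<in>scl T. \<forall>g\<in>K. \<forall>h\<in>K. chi g = chi h) \<and>
     (\<forall>\<psi>. irreducible_character G \<psi> \<longrightarrow> (\<exists>!chi. chi \<in> sch T \<and> constituent G \<psi> chi))"

definition superclass :: "'a sct \<Rightarrow> 'a \<Rightarrow> 'a set" where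
  "superclass T g = (THE K. K \<in> scl T \<and> g \<in> K)"

definition consistent :: "'a sct \<Rightarrow> 'a sct \<Rightarrow> bool" where
  "consistent TH TG \<longleftrightarrow> (\<forall>L\<in>scl TH. \<exists>K\<in>scl TG. L \<subseteq> K)"

definition SPl :: "('a, 'c) monoid_scheme \<Rightarrow> ('a \<Rightarrow> complex) \<Rightarrow> complex" where
  "SPl G chi = 1 / of_nat (card (carrier G)) * ((chi \<one>\<^bsub>G\<^esub>)\<^sup>2 / char_inner G chi chi)"

definition SInd :: "('a, 'c) monoid_scheme \<Rightarrow> 'a set \<Rightarrow> 'a sct \<Rightarrow> ('a \<Rightarrow> complex) \<Rightarrow> 'a \<Rightarrow> complex" where
  "SInd G H TG \<phi> g =
     (if g \<in> carrier G
      then of_nat (card (carrier G)) / (of_nat (card H) * of_nat (card (superclass TG g))) *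
           (\<Sum>k\<in>superclass TG g. if k \<in> H then \<phi> k else 0)
      else 0)"

definition transition :: "('a, 'c) monoid_scheme \<Rightarrow> 'a set \<Rightarrow> 'a sct \<Rightarrow> ('a \<Rightarrow> complex) \<Rightarrow> ('a \<Rightarrow> complex) \<Rightarrow> complex" where
  "transition G H TG \<gamma> chi =
     of_nat (card H) / of_nat (card (carrier G)) * (chi \<one>\<^bsub>G\<^esub> / \<gamma> \<one>\<^bsub>G\<^esub>) *
     (char_inner G (SInd G H TG \<gamma>) chi / char_inner G chi chi)"


section \<open>Towers of embedded groups\<close>

text \<open>For an embedding \<open>emb\<close> of a group with carrier \<open>A\<close> into another group, the supercharacter
  theory on the image that corresponds to a given theory on \<open>A\<close>, i.e. the identification of
  the smaller group with a subgroup of the larger one.\<close>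

definition embed_fun :: "('a \<Rightarrow> 'b) \<Rightarrow> 'a set \<Rightarrow> ('a \<Rightarrow> complex) \<Rightarrow> 'b \<Rightarrow> complex" where
  "embed_fun emb A \<phi> k = (if k \<in> emb ` A then \<phi> (inv_into A emb k) else 0)"

definition embed_theory :: "('a \<Rightarrow> 'b) \<Rightarrow> 'a set \<Rightarrow> 'a sct \<Rightarrow> 'b sct" where
  "embed_theory emb A T = ((`) emb ` scl T, embed_fun emb A ` sch T)"

definition tower_transition ::
    "(nat \<Rightarrow> ('a, 'c) monoid_scheme) \<Rightarrow> (nat \<Rightarrow> 'a \<Rightarrow> 'a) \<Rightarrow> (nat \<Rightarrow> 'a sct) \<Rightarrow>
     nat \<Rightarrow> ('a \<Rightarrow> complex) \<Rightarrow> ('a \<Rightarrow> complex) \<Rightarrow> complex" where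
  "tower_transition G emb T n \<gamma> chi =
     transition (G (Suc n)) (emb n ` carrier (G n)) (T (Suc n))
       (embed_fun (emb n) (carrier (G n)) \<gamma>) chi"


section \<open>Markov processes with discrete state spaces\<close>

text \<open>The process \<open>Y\<close> takes values in \<open>S n\<close> at time \<open>n\<close>. The transition weights are complex
  because \<open>transition\<close> is; the last condition forces them to be real
  and nonnegative at every state visited with positive probability.\<close>

definition markov_process ::
    "'w measure \<Rightarrow> (nat \<Rightarrow> 'w \<Rightarrow> 's) \<Rightarrow> (nat \<Rightarrow> 's set) \<Rightarrow> 's \<Rightarrow> (nat \<Rightarrow> 's \<Rightarrow> 's \<Rightarrow> complex) \<Rightarrow> bool" where
  "markov_process M Y S s0 p \<longleftrightarrow>
     prob_space M \<and>
     (\<forall>n. Y n \<in> measurable M (count_space (S n))) \<and>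
     (AE \<omega> in M. Y 0 \<omega> = s0) \<and>
     (\<forall>n x. (\<forall>i\<le>Suc n. x i \<in> S i) \<longrightarrow> \<P>(\<omega> in M. \<forall>i\<le>n. Y i \<omega> = x i) > 0 \<longrightarrow>
        complex_of_real (\<P>(\<omega> in M. Y (Suc n) \<omega> = x (Suc n) \<bar> \<forall>i\<le>n. Y i \<omega> = x i)) =
          p n (x n) (x (Suc n)))"

end

theory Submission
  imports Defs "Jordan_Normal_Form.Schur_Decomposition" "Jordan_Normal_Form.DL_Rank"
    "HOL-Algebra.Multiplicative_Group"
begin

text \<open>
  The supercharacters are orthogonal and as numerous as the superclasses, so they form a basis of
  the superclass functions; both sum formulas are the corresponding expansions evaluated at the
  identity.  For the sum weighted by \<open>SPl\<close> one expands the restriction of \<open>chi\<close> to the subgroup,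
  after replacing \<open>SInd\<close> by restriction through Frobenius reciprocity.  For the sum of
  the transition weights one expands \<open>SInd \<gamma>\<close>, and the value of \<open>SInd \<gamma>\<close> at the identity is
  known because the superclass of the identity is a singleton: its elements lie in the kernel of
  every irreducible character.  The weights are nonnegative because they are, up to nonnegative
  factors, scalar products of characters, so they define a Markov chain, and the weighted sum
  formula is the induction step for its marginals.
\<close>

section \<open>Traces of complex matrices\<close>

text \<open>The hard point is the identity. Condition (3) speaks of irreducible characters only, so
  for every \<open>k\<close> other than the identity an irreducible character has to be produced
  whose value at \<open>k\<close> has real part below its degree. The search starts from the regular
  representation, whose trace at \<open>k\<close> is 0, and repeatedly passes to an invariant
  subspace or to the quotient by it: degree and trace both add up, so a strict inequality survives
  in one of the two pieces. Eigenvalues control all the traces that matter. Those of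
  \<open>R g\<close> are roots of unity, which bounds the real part of a character by its degree;
  those of an averaged representation are 0 or 1, which makes scalar products of characters
  nonnegative. In the tower a smaller group is met only through its image under an embedding.
  Therefore the linear-algebra content of a theory is isolated as \<open>superclass_basis\<close>,
  and it is this predicate that is carried along embeddings.\<close>

definition mat_trace :: "'a::comm_monoid_add mat \<Rightarrow> 'a" where
  "mat_trace A = (\<Sum>i<dim_row A. A $$ (i, i))"

lemma mat_trace_mult_comm:
  fixes A B :: "'a::comm_semiring_0 mat"
  assumes "A \<in> carrier_mat n m" "B \<in> carrier_mat m n"
  shows "mat_trace (A * B) = mat_trace (B * A)"
proof -
  have "mat_trace (A * B) = (\<Sum>i<n. \<Sum>j<m. A $$ (i, j) * B $$ (j, i))"
    using assms by (auto simp: mat_trace_def scalar_prod_def atLeast0LessThan intro!: sum.cong)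
  also have "\<dots> = (\<Sum>j<m. \<Sum>i<n. B $$ (j, i) * A $$ (i, j))"
    by (subst sum.swap) (simp add: mult.commute)
  also have "\<dots> = mat_trace (B * A)"
    using assms by (auto simp: mat_trace_def scalar_prod_def atLeast0LessThan intro!: sum.cong)
  finally show ?thesis .
qed

lemma mat_trace_similar:
  fixes A P Q :: "'a::comm_semiring_1 mat"
  assumes A: "A \<in> carrier_mat n n" and P: "P \<in> carrier_mat n n" and Q: "Q \<in> carrier_mat n n"
    and PQ: "P * Q = 1\<^sub>m n"
  shows "mat_trace (Q * A * P) = mat_trace A"
proof -
  have "mat_trace (Q * A * P) = mat_trace (P * (Q * A))"
    using assms by (intro mat_trace_mult_comm[of _ n n]) auto
  also have "P * (Q * A) = (P * Q) * A"
    using assms by (intro assoc_mult_mat[symmetric]) auto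
  finally show ?thesis using PQ A by simp
qed

text \<open>Over the complex numbers the characteristic polynomial splits, and its roots, listed
  with multiplicity, form the diagonal of the Schur form; similarity preserves the trace.\<close>

lemma mat_trace_eq_sum_eigenvalues:
  fixes A :: "complex mat"
  assumes A: "A \<in> carrier_mat n n"
  obtains es where "length es = n" "mat_trace A = sum_list es" "\<And>e. e \<in> set es \<Longrightarrow> eigenvalue A e"
proof -
  from char_poly_factorized[OF A] obtain es where
    es: "char_poly A = (\<Prod>a\<leftarrow>es. [:- a, 1:])" "length es = n" by auto
  obtain B P Q where s: "schur_decomposition A es = (B, P, Q)" by (metis prod_cases3)
  note sd = schur_decomposition[OF A es(1) s]
  then have w: "similar_mat_wit A B P Q" and d: "diag_mat B = es" by auto
  note W = similar_mat_witD2[OF A w]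
  have "mat_trace A = mat_trace B"
    using mat_trace_similar[of B n Q P] W by auto
  also have "\<dots> = sum_list (diag_mat B)"
    by (simp add: mat_trace_def diag_mat_def interv_sum_list_conv_sum_set_nat atLeast0LessThan)
  finally have "mat_trace A = sum_list es" using d by simp
  moreover have "eigenvalue A e" if "e \<in> set es" for e
    unfolding eigenvalue_root_char_poly[OF A] es(1) poly_prod_list
    using that by (auto simp: prod_list_zero_iff image_iff intro!: bexI[of _ e])
  ultimately show ?thesis using that es(2) by blast
qed

lemma eigenvalue_pow_one:
  fixes A :: "complex mat"
  assumes A: "A \<in> carrier_mat n n" and "A ^\<^sub>m m = 1\<^sub>m n" and "eigenvalue A e"
  shows "e ^ m = 1"
proof -
  from assms obtain v where ev: "eigenvector A v e" by (auto simp: eigenvalue_def)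
  then have v: "v \<in> carrier_vec n" "v \<noteq> 0\<^sub>v n" using A by (auto simp: eigenvector_def)
  have "v = e ^ m \<cdot>\<^sub>v v"
    using eigenvector_pow[OF A ev, of m] assms v by simp
  moreover obtain i where "i < n" "v $ i \<noteq> 0"
    using v by (metis carrier_vecD eq_vecI index_zero_vec(1) index_zero_vec(2))
  ultimately show ?thesis
    using v by (metis carrier_vecD index_smult_vec(1) mult_cancel_right1)
qed

text \<open>The eigenvalues are \<open>m\<close>-th roots of unity, so each of the \<open>n\<close>
  summands of the trace lies on the unit circle and has real part at most 1.\<close>

lemma Re_mat_trace_le_dim:
  fixes A :: "complex mat"
  assumes A: "A \<in> carrier_mat n n" and m: "m > 0" and p: "A ^\<^sub>m m = 1\<^sub>m n"
  shows "Re (mat_trace A) \<le> n"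
proof -
  obtain es where es: "length es = n" "mat_trace A = sum_list es"
    "\<And>e. e \<in> set es \<Longrightarrow> eigenvalue A e" using mat_trace_eq_sum_eigenvalues[OF A] by metis
  have "Re e \<le> 1" if "e \<in> set es" for e
  proof -
    have "e ^ m = 1" using es(3)[OF that] A p by (rule eigenvalue_pow_one[rotated 2])
    then have "norm e ^ m = 1 ^ m" by (simp flip: norm_power)
    then have "norm e = 1" using m by (metis norm_ge_zero power_eq_imp_eq_base zero_le_one)
    then show ?thesis using complex_Re_le_cmod[of e] by simp
  qed
  then have "Re (sum_list es) \<le> length es"
    by (induction es) (auto simp: add_mono)
  with es show ?thesis by simp
qed

text \<open>The eigenvalues of an idempotent matrix are 0 or 1. The trace is in fact the rank, but
  only its sign matters later.\<close>

lemma mat_trace_idempotent_nonneg: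
  fixes P :: "complex mat"
  assumes P: "P \<in> carrier_mat n n" and i: "P * P = P"
  shows "mat_trace P \<in> \<real>\<^sub>\<ge>\<^sub>0"
proof -
  obtain es where es: "mat_trace P = sum_list es"
    "\<And>e. e \<in> set es \<Longrightarrow> eigenvalue P e" using mat_trace_eq_sum_eigenvalues[OF P] by metis
  have "e \<in> \<real>\<^sub>\<ge>\<^sub>0" if e: "e \<in> set es" for e
  proof -
    from es(2)[OF e] obtain v where v: "v \<in> carrier_vec n" "v \<noteq> 0\<^sub>v n" and Pv: "P *\<^sub>v v = e \<cdot>\<^sub>v v"
      using P by (auto simp: eigenvalue_def eigenvector_def)
    have "e \<cdot>\<^sub>v v = P *\<^sub>v (P *\<^sub>v v)"
      using assoc_mult_mat_vec[OF P P v(1)] i Pv by simp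
    also have "\<dots> = e \<cdot>\<^sub>v (e \<cdot>\<^sub>v v)"
      using P v by (simp add: Pv mult_mat_vec)
    finally have *: "e \<cdot>\<^sub>v v = e \<cdot>\<^sub>v (e \<cdot>\<^sub>v v)" .
    obtain i where i: "i < n" "v $ i \<noteq> 0"
      using v by (metis carrier_vecD eq_vecI index_zero_vec(1) index_zero_vec(2))
    have "e * v $ i = e * (e * v $ i)"
      using arg_cong[OF *, of "\<lambda>w. w $ i"] i v by simp
    then have "e = 0 \<or> e = 1" using i by auto
    then show ?thesis by auto
  qed
  then have "sum_list es \<in> \<real>\<^sub>\<ge>\<^sub>0"
    by (induction es) (auto intro: nonneg_Reals_add_I)
  with es show ?thesis by simp
qed

text \<open>A right inverse of a square matrix is also a left inverse.\<close>
lemma biorthogonal_swap: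
  fixes a :: "'s \<Rightarrow> 't \<Rightarrow> 'f::field" and b :: "'t \<Rightarrow> 's \<Rightarrow> 'f"
  assumes S: "finite S" and U: "finite U" and c: "card S = card U"
    and 1: "\<And>s s'. s \<in> S \<Longrightarrow> s' \<in> S \<Longrightarrow> (\<Sum>t\<in>U. a s t * b t s') = (if s = s' then 1 else 0)"
    and t: "t \<in> U" "t' \<in> U"
  shows "(\<Sum>s\<in>S. b t s * a s t') = (if t = t' then 1 else 0)"
proof -
  let ?n = "card S"
  obtain f where f: "bij_betw f {..<?n} S"
    using ex_bij_betw_nat_finite[OF S] by (auto simp: atLeast0LessThan)
  \<comment> \<open>Equal cardinality enters here: both index sets are enumerated by the same range,
    so the two matrices are square.\<close>
  obtain g where g: "bij_betw g {..<?n} U"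
    using ex_bij_betw_nat_finite[OF U] c by (auto simp: atLeast0LessThan)
  define A where "A = Matrix.mat ?n ?n (\<lambda>(i, j). a (f i) (g j))"
  define B where "B = Matrix.mat ?n ?n (\<lambda>(i, j). b (g i) (f j))"
  have AB: "A \<in> carrier_mat ?n ?n" "B \<in> carrier_mat ?n ?n" by (auto simp: A_def B_def)
  have "A * B = 1\<^sub>m ?n"
  proof (rule eq_matI)
    fix i j assume "i < dim_row (1\<^sub>m ?n :: 'f mat)" "j < dim_col (1\<^sub>m ?n :: 'f mat)"
    then have ij: "i < ?n" "j < ?n" by auto
    then have "(A * B) $$ (i, j) = (\<Sum>k<?n. a (f i) (g k) * b (g k) (f j))"
      by (simp add: A_def B_def scalar_prod_def atLeast0LessThan)
    also have "\<dots> = (\<Sum>t\<in>U. a (f i) t * b t (f j))"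
      by (rule sum.reindex_bij_betw[OF g])
    also have "\<dots> = (if f i = f j then 1 else 0)"
      using ij f by (intro 1) (auto simp: bij_betw_def)
    also have "\<dots> = (1\<^sub>m ?n :: 'f mat) $$ (i, j)"
      using ij f by (auto simp: bij_betw_def inj_on_def)
    finally show "(A * B) $$ (i, j) = (1\<^sub>m ?n :: 'f mat) $$ (i, j)" .
  qed (use AB in auto)
  then have BA: "B * A = 1\<^sub>m ?n" using mat_mult_left_right_inverse AB by blast
  obtain i j where ij: "i < ?n" "j < ?n" "t = g i" "t' = g j"
    using t g by (auto simp: bij_betw_def)
  have "(\<Sum>s\<in>S. b t s * a s t') = (\<Sum>k<?n. b (g i) (f k) * a (f k) (g j))"
    unfolding ij by (rule sum.reindex_bij_betw[OF f, symmetric])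
  also have "\<dots> = (B * A) $$ (i, j)"
    using ij by (simp add: A_def B_def scalar_prod_def atLeast0LessThan)
  also have "\<dots> = (if t = t' then 1 else 0)"
    using BA ij g by (auto simp: bij_betw_def inj_on_def)
  finally show ?thesis .
qed

section \<open>Characters of finite groups\<close>

lemma rep_carrier: "is_rep G n R \<Longrightarrow> g \<in> carrier G \<Longrightarrow> R g \<in> carrier_mat n n"
  by (auto simp: is_rep_def)

lemma rep_mult:
  "is_rep G n R \<Longrightarrow> g \<in> carrier G \<Longrightarrow> h \<in> carrier G \<Longrightarrow> R (g \<otimes>\<^bsub>G\<^esub> h) = R g * R h"
  by (auto simp: is_rep_def)

lemma affords_trace:
  assumes "is_rep G n R" "affords G n R chi" "g \<in> carrier G"
  shows "chi g = mat_trace (R g)"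
  using assms rep_carrier[OF assms(1,3)] by (auto simp: affords_def mat_trace_def)

lemma rep_pow:
  assumes G: "group G" and R: "is_rep G n R" and g: "g \<in> carrier G"
  shows "R (g [^]\<^bsub>G\<^esub> (k::nat)) = R g ^\<^sub>m k"
proof -
  interpret group G by fact
  show ?thesis
  proof (induction k)
    case 0
    then show ?case using R rep_carrier[OF R g] by (auto simp: is_rep_def)
  next
    case (Suc k)
    then show ?case using R g by (simp add: rep_mult)
  qed
qed

lemma character_outside: "is_character G chi \<Longrightarrow> g \<notin> carrier G \<Longrightarrow> chi g = 0"
  by (auto simp: is_character_def affords_def)

lemma affords_one:
  assumes "group G" "is_rep G n R" "affords G n R chi"
  shows "chi \<one>\<^bsub>G\<^esub> = of_nat n"
  using assms by (auto simp: affords_def is_rep_def group.is_monoid)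

lemma character_one_nonneg:
  "group G \<Longrightarrow> is_character G chi \<Longrightarrow> chi \<one>\<^bsub>G\<^esub> \<in> \<real>\<^sub>\<ge>\<^sub>0"
  by (auto simp: is_character_def dest: affords_one)

lemma character_one_nonzero:
  assumes "group G" "is_character G chi" "chi \<noteq> (\<lambda>_. 0)"
  shows "chi \<one>\<^bsub>G\<^esub> \<noteq> 0"
proof -
  from assms(2) obtain n R where R: "is_rep G n R" "affords G n R chi"
    by (auto simp: is_character_def)
  have "n \<noteq> 0"
  proof
    assume "n = 0"
    then have "chi g = 0" for g using R(2) by (simp add: affords_def)
    then show False using assms(3) by auto
  qed
  then show ?thesis using affords_one[OF assms(1) R] by simp
qed

text \<open>Raising \<open>g\<close> to the group order gives the identity, so \<open>R g\<close> is
  a matrix of finite order.\<close>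

lemma Re_rep_trace_le:
  assumes G: "group G" and fin: "finite (carrier G)" and R: "is_rep G n R" and g: "g \<in> carrier G"
  shows "Re (mat_trace (R g)) \<le> n"
proof (rule Re_mat_trace_le_dim)
  interpret group G by fact
  show "R g \<in> carrier_mat n n" using R g by (rule rep_carrier)
  show "0 < order G" using fin by (simp add: order_gt_0_iff_finite)
  have "R g ^\<^sub>m order G = R (g [^]\<^bsub>G\<^esub> order G)" by (rule rep_pow[OF G R g, symmetric])
  also have "\<dots> = 1\<^sub>m n" using pow_order_eq_1[OF g] R by (simp add: is_rep_def)
  finally show "R g ^\<^sub>m order G = 1\<^sub>m n" .
qed

lemma Re_character_le:
  assumes G: "group G" and fin: "finite (carrier G)" and chi: "is_character G chi"
    and g: "g \<in> carrier G"
  shows "Re (chi g) \<le> Re (chi \<one>\<^bsub>G\<^esub>)"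
proof -
  from chi obtain n R where R: "is_rep G n R" "affords G n R chi"
    by (auto simp: is_character_def)
  show ?thesis
    using Re_rep_trace_le[OF G fin R(1) g] affords_trace[OF R g] affords_one[OF G R] by simp
qed

section \<open>Restriction, averages and products of characters\<close>

lemma character_subgroup:
  assumes H: "subgroup H G" and chi: "is_character G chi"
  shows "is_character (G\<lparr>carrier := H\<rparr>) (\<lambda>h. if h \<in> H then chi h else 0)"
proof -
  interpret subgroup H G by fact
  from chi obtain n R where R: "is_rep G n R" "affords G n R chi"
    by (auto simp: is_character_def)
  then have "is_rep (G\<lparr>carrier := H\<rparr>) n R"
    "affords (G\<lparr>carrier := H\<rparr>) n R (\<lambda>h. if h \<in> H then chi h else 0)"
    by (auto simp: is_rep_def affords_def)
  then show ?thesis by (auto simp: is_character_def)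
qed

text \<open>The average of a representation is the projection onto its fixed vectors.\<close>
lemma character_sum_nonneg:
  assumes G: "group G" and fin: "finite (carrier G)" and chi: "is_character G chi"
  shows "(\<Sum>g\<in>carrier G. chi g) / of_nat (card (carrier G)) \<in> \<real>\<^sub>\<ge>\<^sub>0"
proof -
  interpret group G by fact
  let ?N = "of_nat (card (carrier G)) :: complex"
  have N: "?N \<noteq> 0" using fin by (auto simp: card_eq_0_iff)
  from chi obtain n R where R: "is_rep G n R" "affords G n R chi"
    by (auto simp: is_character_def)
  note [simp] = rep_carrier[OF R(1)]
  define P where "P = Matrix.mat n n (\<lambda>(i, j). (\<Sum>g\<in>carrier G. R g $$ (i, j)) / ?N)"
  have P: "P \<in> carrier_mat n n" by (simp add: P_def)
  \<comment> \<open>Up to the factor \<open>1 / ?N\<close> this is \<open>R h * P = P\<close>: left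
    translation by \<open>h\<close> permutes the summands. Averaging it over \<open>h\<close> gives
    idempotence.\<close>
  have shift: "(\<Sum>k<n. R h $$ (i, k) * (\<Sum>g\<in>carrier G. R g $$ (k, j))) = (\<Sum>g\<in>carrier G. R g $$ (i, j))"
    if h: "h \<in> carrier G" and ij: "i < n" "j < n" for h i j
  proof -
    have "(\<Sum>k<n. R h $$ (i, k) * (\<Sum>g\<in>carrier G. R g $$ (k, j))) =
      (\<Sum>g\<in>carrier G. \<Sum>k<n. R h $$ (i, k) * R g $$ (k, j))"
      by (subst sum.swap) (simp add: sum_distrib_left)
    also have "\<dots> = (\<Sum>g\<in>carrier G. R (h \<otimes>\<^bsub>G\<^esub> g) $$ (i, j))"
    proof (rule sum.cong[OF refl])
      fix g assume g: "g \<in> carrier G"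
      have "R h \<in> carrier_mat n n" "R g \<in> carrier_mat n n" using g h by auto
      then show "(\<Sum>k<n. R h $$ (i, k) * R g $$ (k, j)) = R (h \<otimes>\<^bsub>G\<^esub> g) $$ (i, j)"
        using ij by (simp add: rep_mult[OF R(1) h g] scalar_prod_def atLeast0LessThan)
    qed
    also have "\<dots> = (\<Sum>g\<in>carrier G. R g $$ (i, j))"
      using surj_const_mult[OF h] inj_on_cmult[OF h]
      by (intro sum.reindex_bij_betw[of "\<lambda>g. h \<otimes>\<^bsub>G\<^esub> g" "carrier G" "carrier G" "\<lambda>g. R g $$ (i, j)"])
         (auto simp: bij_betw_def)
    finally show ?thesis .
  qed
  have "P * P = P"
  proof (rule eq_matI)
    fix i j assume "i < dim_row P" "j < dim_col P"
    then have ij: "i < n" "j < n" using P by auto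
    then have "(P * P) $$ (i, j) = (\<Sum>k<n. (\<Sum>h\<in>carrier G. R h $$ (i, k)) / ?N * ((\<Sum>g\<in>carrier G. R g $$ (k, j)) / ?N))"
      by (simp add: P_def scalar_prod_def atLeast0LessThan)
    also have "\<dots> = (\<Sum>k<n. \<Sum>h\<in>carrier G. R h $$ (i, k) * (\<Sum>g\<in>carrier G. R g $$ (k, j))) / (?N * ?N)"
      by (simp only: times_divide_times_eq sum_divide_distrib[symmetric] sum_distrib_right)
    also have "\<dots> = (\<Sum>h\<in>carrier G. \<Sum>k<n. R h $$ (i, k) * (\<Sum>g\<in>carrier G. R g $$ (k, j))) / (?N * ?N)"
      by (subst sum.swap) simp
    also have "\<dots> = (\<Sum>h\<in>carrier G. \<Sum>g\<in>carrier G. R g $$ (i, j)) / (?N * ?N)"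
      using shift ij by (intro arg_cong2[of _ _ _ _ "(/)"] sum.cong refl) auto
    also have "\<dots> = P $$ (i, j)"
      using ij N by (simp add: P_def)
    finally show "(P * P) $$ (i, j) = P $$ (i, j)" .
  qed (use P in auto)
  then have "mat_trace P \<in> \<real>\<^sub>\<ge>\<^sub>0" by (rule mat_trace_idempotent_nonneg[OF P])
  also have "mat_trace P = (\<Sum>g\<in>carrier G. chi g) / ?N"
    using R(2) by (simp add: mat_trace_def P_def affords_def sum_divide_distrib) (subst sum.swap, simp)
  finally show ?thesis .
qed

text \<open>Afforded by the Kronecker product of a representation with the entrywise conjugate of another.\<close>
lemma character_mult_cnj:
  assumes G: "group G" and chi: "is_character G chi" and psi: "is_character G \<psi>"
  shows "is_character G (\<lambda>g. chi g * cnj (\<psi> g))"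
proof -
  interpret group G by fact
  from chi obtain n R where R: "is_rep G n R" "affords G n R chi"
    by (auto simp: is_character_def)
  from psi obtain m S where S: "is_rep G m S" "affords G m S \<psi>"
    by (auto simp: is_character_def)
  \<comment> \<open>A pair \<open>(a, b)\<close> of indices is stored as \<open>a * m + b\<close>,
    and \<open>div\<close> and \<open>mod\<close> by \<open>m\<close> recover it. Conjugation
    respects sums and products, so conjugating the entries of \<open>S\<close> keeps it
    multiplicative.\<close>
  define K where "K g = Matrix.mat (n * m) (n * m)
    (\<lambda>(i, j). R g $$ (i div m, j div m) * cnj (S g $$ (i mod m, j mod m)))" for g
  have dm: "i div m < n" "i mod m < m" if "i < n * m" for i
    using that by (auto simp: less_mult_imp_div_less) (metis mod_less_divisor mult_0_right not_gr_zero not_less_zero)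
  have split: "(\<Sum>i<n * m. f (i div m) (i mod m)) = (\<Sum>a<n. \<Sum>b<m. f a b)" for f :: "nat \<Rightarrow> nat \<Rightarrow> complex"
  proof -
    have "(\<Sum>a<n. \<Sum>b<m. f a b) = (\<Sum>(a, b)\<in>{..<n} \<times> {..<m}. f a b)"
      by (rule sum.cartesian_product)
    also have "\<dots> = (\<Sum>i<n * m. f (i div m) (i mod m))"
    proof (rule sum.reindex_bij_witness[of _ "\<lambda>i. (i div m, i mod m)" "\<lambda>(a, b). a * m + b"])
      fix p assume p: "p \<in> {..<n} \<times> {..<m}"
      then obtain a b where ab: "p = (a, b)" "a < n" "b < m" by auto
      have "a * m + b < Suc a * m" using ab by simp
      also have "\<dots> \<le> n * m" using ab by (intro mult_right_mono) auto
      finally show "(case p of (a, b) \<Rightarrow> a * m + b) \<in> {..<n * m}" using ab by simp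
    qed (auto simp: dm)
    finally show ?thesis by simp
  qed
  have "is_rep G (n * m) K"
    unfolding is_rep_def
  proof (intro conjI ballI)
    show "K \<one>\<^bsub>G\<^esub> = 1\<^sub>m (n * m)"
    proof (rule eq_matI)
      fix i j assume "i < dim_row (1\<^sub>m (n * m) :: complex mat)" "j < dim_col (1\<^sub>m (n * m) :: complex mat)"
      then have ij: "i < n * m" "j < n * m" by auto
      have "i = j \<longleftrightarrow> i div m = j div m \<and> i mod m = j mod m"
        by (metis div_mult_mod_eq)
      then show "K \<one>\<^bsub>G\<^esub> $$ (i, j) = 1\<^sub>m (n * m) $$ (i, j)"
        using ij dm[OF ij(1)] dm[OF ij(2)] R(1) S(1) by (simp add: K_def is_rep_def)
    qed (auto simp: K_def)
  next
    fix g h assume g: "g \<in> carrier G" and h: "h \<in> carrier G"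
    note c = rep_carrier[OF R(1) g] rep_carrier[OF R(1) h] rep_carrier[OF S(1) g] rep_carrier[OF S(1) h]
    show "K (g \<otimes>\<^bsub>G\<^esub> h) = K g * K h"
    proof (rule eq_matI)
      fix i j assume "i < dim_row (K g * K h)" "j < dim_col (K g * K h)"
      then have ij: "i < n * m" "j < n * m" by (auto simp: K_def)
      have "(K g * K h) $$ (i, j) = (\<Sum>k<n * m. R g $$ (i div m, k div m) * cnj (S g $$ (i mod m, k mod m)) *
         (R h $$ (k div m, j div m) * cnj (S h $$ (k mod m, j mod m))))"
        using ij by (simp add: K_def scalar_prod_def atLeast0LessThan)
      also have "\<dots> = (\<Sum>a<n. \<Sum>b<m. R g $$ (i div m, a) * cnj (S g $$ (i mod m, b)) *
         (R h $$ (a, j div m) * cnj (S h $$ (b, j mod m))))"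
        by (rule split)
      also have "\<dots> = (\<Sum>a<n. R g $$ (i div m, a) * R h $$ (a, j div m)) *
          cnj (\<Sum>b<m. S g $$ (i mod m, b) * S h $$ (b, j mod m))"
        by (simp add: sum_product mult.assoc mult.left_commute)
      also have "\<dots> = (R g * R h) $$ (i div m, j div m) * cnj ((S g * S h) $$ (i mod m, j mod m))"
        using dm[OF ij(1)] dm[OF ij(2)] c by (simp add: scalar_prod_def atLeast0LessThan)
      also have "\<dots> = K (g \<otimes>\<^bsub>G\<^esub> h) $$ (i, j)"
        using ij by (simp add: K_def rep_mult[OF R(1) g h] rep_mult[OF S(1) g h])
      finally show "K (g \<otimes>\<^bsub>G\<^esub> h) $$ (i, j) = (K g * K h) $$ (i, j)" ..
    qed (auto simp: K_def)
  qed (auto simp: K_def)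
  moreover have "affords G (n * m) K (\<lambda>g. chi g * cnj (\<psi> g))"
    using R(2) S(2)
    by (auto simp: affords_def K_def sum_product split[of "\<lambda>a b. R g $$ (a, a) * cnj (S g $$ (b, b))" for g])
  ultimately show ?thesis by (auto simp: is_character_def)
qed

text \<open>The scalar product is the average of the character \<open>chi * cnj \<psi>\<close>, that
  is, the trace of a projection. Nonnegativity is obtained this way without decomposing either
  character into irreducible ones.\<close>

lemma char_inner_nonneg:
  assumes "group G" "finite (carrier G)" "is_character G chi" "is_character G \<psi>"
  shows "char_inner G chi \<psi> \<in> \<real>\<^sub>\<ge>\<^sub>0"
  using character_sum_nonneg[OF assms(1,2) character_mult_cnj[OF assms(1,3,4)]]
  by (simp add: char_inner_def)

lemma char_inner_self_nonzero:
  assumes fin: "finite (carrier G)" and chi: "is_character G chi" "chi \<noteq> (\<lambda>_. 0)"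
  shows "char_inner G chi chi \<noteq> 0"
proof
  from chi obtain g where g: "chi g \<noteq> 0" "g \<in> carrier G"
    using character_outside[OF chi(1)] by (metis ext)
  assume "char_inner G chi chi = 0"
  then have "(\<Sum>g\<in>carrier G. chi g * cnj (chi g)) = 0"
    using fin g by (auto simp: char_inner_def)
  also have "(\<Sum>g\<in>carrier G. chi g * cnj (chi g)) = of_real (\<Sum>g\<in>carrier G. (cmod (chi g))\<^sup>2)"
    by (simp only: of_real_sum complex_norm_square)
  finally have "(\<Sum>g\<in>carrier G. (cmod (chi g))\<^sup>2) = 0" by (simp only: of_real_eq_0_iff)
  then show False using fin g by (simp add: sum_nonneg_eq_0_iff)
qed

lemma char_inner_cnj: "char_inner G \<phi> \<psi> = cnj (char_inner G \<psi> \<phi>)"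
  by (simp add: char_inner_def mult.commute)

section \<open>Irreducible characters separate the identity\<close>

text \<open>The columns of \<open>P\<close> are a basis of the whole space that begins with a basis
  of \<open>W\<close>. In these coordinates a matrix that preserves \<open>W\<close> has a vanishing
  lower left block. \<open>P\<close> and \<open>Q\<close> are fixed before \<open>A\<close>, so one
  change of basis serves all the matrices of a representation at once.\<close>

lemma invariant_subspace_block_triangular:
  fixes W :: "complex vec set"
  assumes W: "VectorSpace.subspace class_ring W (module_vec TYPE(complex) n)"
    and W0: "W \<noteq> {0\<^sub>v n}" and W1: "W \<noteq> carrier_vec n"
  obtains d P Q where "0 < d" "d < n" "P \<in> carrier_mat n n" "Q \<in> carrier_mat n n"
    "P * Q = 1\<^sub>m n" "Q * P = 1\<^sub>m n"
    "\<And>A i j. A \<in> carrier_mat n n \<Longrightarrow> (\<And>w. w \<in> W \<Longrightarrow> A *\<^sub>v w \<in> W) \<Longrightarrow> d \<le> i \<Longrightarrow> i < n \<Longrightarrow> j < d \<Longrightarrow>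
      (Q * A * P) $$ (i, j) = 0"
proof -
  interpret vec_space "TYPE(complex)" n .
  have Wsub: "submodule class_ring W V" using W is_module by blast
  have Wc: "W \<subseteq> carrier_vec n" and W0in: "0\<^sub>v n \<in> W"
    using Wsub by (auto simp: submodule_def module_vec_simps)
  have fd: "finite S \<and> card S \<le> n" if "S \<subseteq> carrier_vec n" "lin_indpt S" for S
    using li_le_dim[OF fin_dim, of S] that dim_is_n by simp
  have empty: "lin_indpt {}" by (simp add: lin_dep_def)
  have "\<exists>B. finite B \<and> maximal B (\<lambda>S. S \<subseteq> W \<and> lin_indpt S)"
    by (rule maximal_exists[of _ n "{}"]) (use fd Wc empty in auto)
  then obtain B where "finite B" and Bmax: "maximal B (\<lambda>S. S \<subseteq> W \<and> lin_indpt S)" by blast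
  then have B: "B \<subseteq> W" "lin_indpt B" by (auto simp: maximal_def)
  then have Bc: "B \<subseteq> carrier_vec n" using Wc by auto
  have spanB: "W \<subseteq> span B"
  proof
    fix w assume w: "w \<in> W"
    show "w \<in> span B"
    proof (rule ccontr)
      assume ns: "w \<notin> span B"
      then have nB: "w \<notin> B" using in_own_span[of B] Bc by auto
      then have "lin_indpt (B \<union> {w})"
        using lin_dep_iff_in_span[of B w] B Bc w Wc ns by auto
      then have "B \<union> {w} = B" using Bmax B w unfolding maximal_def by blast
      then show False using nB by auto
    qed
  qed
  have "\<exists>C. finite C \<and> maximal C (\<lambda>S. B \<subseteq> S \<and> S \<subseteq> carrier_vec n \<and> lin_indpt S)"
    by (rule maximal_exists[of _ n B]) (use fd B Bc in auto)
  then obtain C where "finite C"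
    and Cmax: "maximal C (\<lambda>S. B \<subseteq> S \<and> S \<subseteq> carrier_vec n \<and> lin_indpt S)" by blast
  then have C: "B \<subseteq> C" "C \<subseteq> carrier_vec n" "lin_indpt C" by (auto simp: maximal_def)
  \<comment> \<open>An independent set containing \<open>C\<close> also contains \<open>B\<close>,
    so maximality among the supersets of \<open>B\<close> is maximality among all independent
    sets.\<close>
  have "maximal C (\<lambda>S. S \<subseteq> carrier_vec n \<and> lin_indpt S)"
    using Cmax C(1) by (simp add: maximal_def) (metis order_trans)
  then have Cb: "basis C" by (rule max_li_is_basis)
  then have cardC: "card C = n" using dim_basis[OF \<open>finite C\<close>] dim_is_n by simp
  obtain bs where bs: "set bs = B" "distinct bs" using finite_distinct_list[OF \<open>finite B\<close>] by blast
  obtain cs where cs: "set cs = C - B" "distinct cs"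
    using finite_distinct_list[of "C - B"] \<open>finite C\<close> by blast
  define ws where "ws = bs @ cs"
  define d where "d = length bs"
  have ws: "distinct ws" "set ws = C" using bs cs C by (auto simp: ws_def)
  then have len: "length ws = n" using distinct_card[of ws] cardC by simp
  define P where "P = mat_of_cols n ws"
  have P: "P \<in> carrier_mat n n" using len by (auto simp: P_def)
  have cols: "cols P = ws" using len ws C by (auto simp: P_def)
  have "det P \<noteq> 0"
    using det_rank_iff[OF P] lin_indpt_full_rank[OF P] cols ws C by simp
  then obtain Q where Q: "Q \<in> carrier_mat n n" "P * Q = 1\<^sub>m n" "Q * P = 1\<^sub>m n"
    using det_non_zero_imp_unit[OF P, of "()"] by (auto simp: Units_def ring_mat_simps)
  have "d \<noteq> 0"
  proof
    assume "d = 0"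
    then have "B = {}" using bs by (simp add: d_def)
    then have "W \<subseteq> {0\<^sub>v n}" using spanB span_empty by simp
    then show False using W0 W0in by auto
  qed
  moreover have "d < n"
  proof (rule ccontr)
    assume "\<not> d < n"
    then have "cs = []" using len by (auto simp: ws_def d_def)
    then have "B = C" using cs C by auto
    then have "span B = carrier_vec n" using Cb by (simp add: basis_def)
    moreover have "span B \<subseteq> W" using span_is_subset[OF B(1) Wsub] .
    ultimately show False using W1 Wc by auto
  qed
  moreover have "(Q * A * P) $$ (i, j) = 0"
    if A: "A \<in> carrier_mat n n" and inv: "\<And>w. w \<in> W \<Longrightarrow> A *\<^sub>v w \<in> W" and ij: "d \<le> i" "i < n" "j < d" for A i j
  proof -
    have jn: "j < n" using ij by simp
    have "col P j = bs ! j"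
      using cols jn P ij by (metis carrier_matD(2) cols_nth d_def nth_append ws_def)
    then have cj: "col P j \<in> W" using ij bs B by (auto simp: d_def)
    then have "A *\<^sub>v col P j \<in> span B" using inv spanB by auto
    then obtain a where a: "A *\<^sub>v col P j = lincomb a B"
      using finite_span[OF \<open>finite B\<close>] Bc by auto
    \<comment> \<open>The image of a basis vector of \<open>W\<close> is a combination of
      \<open>B\<close> alone. Extending its coefficients by 0 to all of \<open>C\<close> exhibits
      the coordinate vector with respect to the columns of \<open>P\<close>, whose entries at
      positions \<open>i \<ge> d\<close> are therefore 0.\<close>
    define a' where "a' v = (if v \<in> B then a v else 0)" for v
    have "lincomb a B = lincomb a' C"
    proof (rule eq_vecI)
      fix l assume "l < dim_vec (lincomb a' C)"
      then have l: "l < n" using lincomb_dim[OF \<open>finite C\<close> C(2)] by simp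
      show "lincomb a B $ l = lincomb a' C $ l"
        unfolding lincomb_index[OF l Bc] lincomb_index[OF l C(2)]
        using C(1) \<open>finite C\<close> by (intro sum.mono_neutral_cong_left) (auto simp: a'_def)
    qed (simp add: lincomb_dim[OF \<open>finite B\<close> Bc] lincomb_dim[OF \<open>finite C\<close> C(2)])
    also have "\<dots> = P *\<^sub>v vec n (\<lambda>i. a' (col P i))"
      using mat_mult_eq_lincomb[OF P, of a'] cols ws by simp
    finally have AP: "A *\<^sub>v col P j = P *\<^sub>v vec n (\<lambda>i. a' (col P i))" using a by simp
    have "col P i = cs ! (i - d)" "i - d < length cs"
      using cols P ij len by (simp_all add: ws_def d_def nth_append flip: cols_nth)
    then have "col P i \<notin> B" using cs by (metis DiffD2 nth_mem)
    have "(Q * A * P) $$ (i, j) = col (Q * A * P) j $ i"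
      using A P Q ij by simp
    also have "col (Q * A * P) j = (Q * A) *\<^sub>v col P j"
      using A P Q ij by (intro col_mult2[of _ n n _ n]) auto
    also have "\<dots> = Q *\<^sub>v (A *\<^sub>v col P j)"
      using A P Q jn by (intro assoc_mult_mat_vec[of _ n n _ n]) auto
    also have "\<dots> = (Q * P) *\<^sub>v vec n (\<lambda>i. a' (col P i))"
      unfolding AP using P Q by (intro assoc_mult_mat_vec[symmetric, of _ n n _ n]) auto
    also have "\<dots> $ i = 0"
      using Q ij \<open>col P i \<notin> B\<close> by (simp add: a'_def)
    finally show ?thesis .
  qed
  ultimately show ?thesis using that[of d P Q] P Q by auto
qed

text \<open>\<open>R1\<close> is the action on \<open>W\<close> and \<open>R2\<close> the action on
  the quotient by \<open>W\<close>. They are the diagonal blocks of simultaneously block triangular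
  matrices, hence multiplicative, and their traces add up to that of \<open>R\<close>.\<close>

lemma rep_split:
  assumes R: "is_rep G n R"
    and W: "VectorSpace.subspace class_ring W (module_vec TYPE(complex) n)"
    and inv: "\<And>g w. g \<in> carrier G \<Longrightarrow> w \<in> W \<Longrightarrow> R g *\<^sub>v w \<in> W"
    and W0: "W \<noteq> {0\<^sub>v n}" and W1: "W \<noteq> carrier_vec n"
  obtains d R1 R2 where "0 < d" "d < n" "is_rep G d R1" "is_rep G (n - d) R2"
    "\<And>g. g \<in> carrier G \<Longrightarrow> mat_trace (R g) = mat_trace (R1 g) + mat_trace (R2 g)"
proof -
  obtain d P Q where d: "0 < d" "d < n" and P: "P \<in> carrier_mat n n" and Q: "Q \<in> carrier_mat n n"
    and PQ: "P * Q = 1\<^sub>m n" and QP: "Q * P = 1\<^sub>m n"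
    and z: "\<And>A i j. A \<in> carrier_mat n n \<Longrightarrow> (\<And>w. w \<in> W \<Longrightarrow> A *\<^sub>v w \<in> W) \<Longrightarrow> d \<le> i \<Longrightarrow> i < n \<Longrightarrow> j < d \<Longrightarrow>
      (Q * A * P) $$ (i, j) = 0"
    using invariant_subspace_block_triangular[OF W W0 W1] by blast
  define A where "A g = Q * R g * P" for g
  note Rc = rep_carrier[OF R]
  have Ac: "A g \<in> carrier_mat n n" if "g \<in> carrier G" for g
    using Rc[OF that] P Q by (simp add: A_def)
  have A0: "A g $$ (i, j) = 0" if "g \<in> carrier G" "d \<le> i" "i < n" "j < d" for g i j
    unfolding A_def using z[OF Rc] inv that by blast
  have A1: "A \<one>\<^bsub>G\<^esub> = 1\<^sub>m n"
    using R P Q QP by (simp add: A_def is_rep_def)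
  have Am: "A (g \<otimes>\<^bsub>G\<^esub> h) = A g * A h" if g: "g \<in> carrier G" and h: "h \<in> carrier G" for g h
  proof -
    have "A g * A h = Q * R g * (P * Q) * R h * P"
      using Rc[OF g] Rc[OF h] P Q by (simp add: A_def assoc_mult_mat[of _ n n _ n _ n])
    also have "\<dots> = A (g \<otimes>\<^bsub>G\<^esub> h)"
      using Rc[OF g] Rc[OF h] P Q by (simp add: A_def PQ rep_mult[OF R g h] assoc_mult_mat[of _ n n _ n _ n])
    finally show ?thesis ..
  qed
  have Ami: "A (g \<otimes>\<^bsub>G\<^esub> h) $$ (i, j) = (\<Sum>k<n. A g $$ (i, k) * A h $$ (k, j))"
    if "g \<in> carrier G" "h \<in> carrier G" "i < n" "j < n" for g h i j
    using that Ac[OF that(1)] Ac[OF that(2)] by (simp add: Am scalar_prod_def atLeast0LessThan)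
  define R1 where "R1 g = Matrix.mat d d (\<lambda>(i, j). A g $$ (i, j))" for g
  define R2 where "R2 g = Matrix.mat (n - d) (n - d) (\<lambda>(i, j). A g $$ (i + d, j + d))" for g
  have shift: "(\<Sum>k\<in>{d..<n}. f k) = (\<Sum>k<n - d. f (k + d))" for f :: "nat \<Rightarrow> complex"
    using d sum.shift_bounds_nat_ivl[of f 0 d "n - d"] by (simp add: atLeast0LessThan)
  \<comment> \<open>Splits the inner index of a matrix product at \<open>d\<close>. The unwanted
    part of the sum vanishes by \<open>A0\<close>, applied to the right factor \<open>h\<close> for
    \<open>R1\<close> and to the left factor \<open>g\<close> for \<open>R2\<close>.\<close>
  have cut: "(\<Sum>k<n. f k) = (\<Sum>k<d. f k) + (\<Sum>k<n - d. f (k + d))" for f :: "nat \<Rightarrow> complex"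
    using sum.atLeastLessThan_concat[of 0 d n f] shift[of f] d by (simp add: atLeast0LessThan)
  have "is_rep G d R1"
    unfolding is_rep_def
  proof (intro conjI ballI)
    show "R1 \<one>\<^bsub>G\<^esub> = 1\<^sub>m d" using d by (intro eq_matI) (auto simp: R1_def A1)
    fix g h assume g: "g \<in> carrier G" and h: "h \<in> carrier G"
    show "R1 (g \<otimes>\<^bsub>G\<^esub> h) = R1 g * R1 h"
      using d by (intro eq_matI)
        (auto simp: R1_def Ami[OF g h] cut A0[OF h] scalar_prod_def atLeast0LessThan)
  qed (auto simp: R1_def)
  moreover have "is_rep G (n - d) R2"
    unfolding is_rep_def
  proof (intro conjI ballI)
    show "R2 \<one>\<^bsub>G\<^esub> = 1\<^sub>m (n - d)" using d by (intro eq_matI) (auto simp: R2_def A1)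
    fix g h assume g: "g \<in> carrier G" and h: "h \<in> carrier G"
    show "R2 (g \<otimes>\<^bsub>G\<^esub> h) = R2 g * R2 h"
      using d by (intro eq_matI)
        (auto simp: R2_def Ami[OF g h] cut A0[OF g] scalar_prod_def atLeast0LessThan)
  qed (auto simp: R2_def)
  moreover have "mat_trace (R g) = mat_trace (R1 g) + mat_trace (R2 g)" if g: "g \<in> carrier G" for g
  proof -
    have "mat_trace (R g) = mat_trace (A g)"
      unfolding A_def using mat_trace_similar[OF Rc[OF g] P Q PQ] ..
    also have "\<dots> = (\<Sum>i<n. A g $$ (i, i))" using Ac[OF g] by (simp add: mat_trace_def)
    also have "\<dots> = mat_trace (R1 g) + mat_trace (R2 g)"
      by (simp add: cut mat_trace_def R1_def R2_def)
    finally show ?thesis .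
  qed
  ultimately show ?thesis using that d by blast
qed

text \<open>A representation of least degree on which \<open>k\<close> has a trace with real part below the degree
  is irreducible, because traces and degrees are additive and the bound always holds weakly.\<close>
lemma irreducible_character_separating:
  assumes G: "group G" and fin: "finite (carrier G)" and k: "k \<in> carrier G"
    and "is_rep G n R" and "Re (mat_trace (R k)) < n"
  shows "\<exists>\<psi>. irreducible_character G \<psi> \<and> Re (\<psi> k) < Re (\<psi> \<one>\<^bsub>G\<^esub>)"
  using assms(4,5)
proof (induction n arbitrary: R rule: less_induct)
  case (less n)
  interpret group G by fact
  note R = less.prems(1)
  show ?case
  proof (cases "irreducible_rep G n R")
    case True
    define \<psi> where "\<psi> g = (if g \<in> carrier G then (\<Sum>i<n. R g $$ (i, i)) else 0)" for g
    have aff: "affords G n R \<psi>" by (simp add: affords_def \<psi>_def)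
    then have "irreducible_character G \<psi>" using True by (auto simp: irreducible_character_def)
    moreover have "Re (\<psi> k) < Re (\<psi> \<one>\<^bsub>G\<^esub>)"
      using affords_trace[OF R aff k] affords_one[OF G R aff] less.prems(2) by simp
    ultimately show ?thesis by blast
  next
    case False
    \<comment> \<open>Degree 0 is excluded from irreducibility by definition, so it must be ruled
      out before failure of irreducibility yields an invariant subspace; the strict inequality rules
      it out.\<close>
    have "n \<noteq> 0"
    proof
      assume "n = 0"
      then have "mat_trace (R k) = 0" using rep_carrier[OF R k] by (simp add: mat_trace_def)
      then show False using less.prems(2) \<open>n = 0\<close> by simp
    qed
    with False R obtain W where W: "VectorSpace.subspace class_ring W (module_vec TYPE(complex) n)"
      "\<And>g w. g \<in> carrier G \<Longrightarrow> w \<in> W \<Longrightarrow> R g *\<^sub>v w \<in> W" "W \<noteq> {0\<^sub>v n}" "W \<noteq> carrier_vec n"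
      by (auto simp: irreducible_rep_def)
    obtain d R1 R2 where d: "0 < d" "d < n" and R12: "is_rep G d R1" "is_rep G (n - d) R2"
      and tr: "\<And>g. g \<in> carrier G \<Longrightarrow> mat_trace (R g) = mat_trace (R1 g) + mat_trace (R2 g)"
      using rep_split[OF R W] by blast
    \<comment> \<open>If both inequalities failed, adding them would give
      \<open>n \<le> Re (mat_trace (R k))\<close>.\<close>
    have "Re (mat_trace (R1 k)) < d \<or> Re (mat_trace (R2 k)) < (n - d)"
      using tr[OF k] less.prems(2) d by auto
    then show ?thesis
      using less.IH[of d R1] less.IH[of "n - d" R2] R12 d by auto
  qed
qed

text \<open>The permutation matrices of left multiplication. Translation by a nontrivial element has
  no fixed point, so the diagonal of its matrix is 0; this is the starting point for separating that
  element from the identity.\<close>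

lemma regular_rep:
  assumes G: "group G" and fin: "finite (carrier G)"
  obtains R where "is_rep G (card (carrier G)) R"
    "\<And>k. k \<in> carrier G \<Longrightarrow> k \<noteq> \<one>\<^bsub>G\<^esub> \<Longrightarrow> mat_trace (R k) = 0"
proof -
  interpret group G by fact
  let ?N = "card (carrier G)"
  obtain e where e: "bij_betw e {..<?N} (carrier G)"
    using ex_bij_betw_nat_finite[OF fin] by (auto simp: atLeast0LessThan)
  have ec: "e i \<in> carrier G" if "i < ?N" for i using e that by (auto simp: bij_betw_def)
  have inj: "e i = e j \<longleftrightarrow> i = j" if "i < ?N" "j < ?N" for i j
    using e that by (auto simp: bij_betw_def inj_on_def)
  define R where "R g = Matrix.mat ?N ?N (\<lambda>(i, j). if e i = g \<otimes>\<^bsub>G\<^esub> e j then 1 else (0 :: complex))" for g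
  have "is_rep G ?N R"
    unfolding is_rep_def
  proof (intro conjI ballI)
    show "R \<one>\<^bsub>G\<^esub> = 1\<^sub>m ?N" by (intro eq_matI) (auto simp: R_def ec inj)
    fix g h assume g: "g \<in> carrier G" and h: "h \<in> carrier G"
    show "R (g \<otimes>\<^bsub>G\<^esub> h) = R g * R h"
    proof (rule eq_matI)
      fix i j assume "i < dim_row (R g * R h)" "j < dim_col (R g * R h)"
      then have ij: "i < ?N" "j < ?N" by (auto simp: R_def)
      then have "(R g * R h) $$ (i, j) =
          (\<Sum>k<?N. (if e i = g \<otimes>\<^bsub>G\<^esub> e k then 1 else 0) * (if e k = h \<otimes>\<^bsub>G\<^esub> e j then 1 else 0))"
        by (simp add: R_def scalar_prod_def atLeast0LessThan)
      also have "\<dots> = (\<Sum>x\<in>carrier G. (if e i = g \<otimes>\<^bsub>G\<^esub> x then 1 else 0) * (if x = h \<otimes>\<^bsub>G\<^esub> e j then 1 else 0))"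
        by (rule sum.reindex_bij_betw[OF e])
      also have "\<dots> = (\<Sum>x\<in>carrier G. if x = h \<otimes>\<^bsub>G\<^esub> e j then (if e i = g \<otimes>\<^bsub>G\<^esub> x then 1 else 0) else 0)"
        by (intro sum.cong) auto
      also have "\<dots> = R (g \<otimes>\<^bsub>G\<^esub> h) $$ (i, j)"
        using fin g h ij ec by (simp add: R_def m_assoc)
      finally show "R (g \<otimes>\<^bsub>G\<^esub> h) $$ (i, j) = (R g * R h) $$ (i, j)" ..
    qed (auto simp: R_def)
  qed (auto simp: R_def)
  moreover have "mat_trace (R k) = 0" if "k \<in> carrier G" "k \<noteq> \<one>\<^bsub>G\<^esub>" for k
    using that ec by (auto simp: mat_trace_def R_def intro!: sum.neutral)
  ultimately show ?thesis using that by blast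
qed

lemma irreducible_characters_separate_one:
  assumes G: "group G" and fin: "finite (carrier G)" and k: "k \<in> carrier G" "k \<noteq> \<one>\<^bsub>G\<^esub>"
  obtains \<psi> where "irreducible_character G \<psi>" "Re (\<psi> k) < Re (\<psi> \<one>\<^bsub>G\<^esub>)"
proof -
  obtain R where R: "is_rep G (card (carrier G)) R" "mat_trace (R k) = 0"
    using regular_rep[OF G fin] k by metis
  have "card (carrier G) > 0" using fin k by (auto simp: card_gt_0_iff)
  then show ?thesis
    using irreducible_character_separating[OF G fin k(1) R(1)] R(2) that by auto
qed

section \<open>Superclass functions and superinduction\<close>

text \<open>The conditions that make the supercharacters a basis of the superclass functions. They
  are stable under transport along an embedding, as \<open>embed_superclass_basis\<close>
  shows.\<close>

definition superclass_basis :: "('a, 'c) monoid_scheme \<Rightarrow> 'a sct \<Rightarrow> bool" where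
  "superclass_basis G T \<longleftrightarrow>
     partition_on (carrier G) (scl T) \<and>
     (\<forall>chi\<in>sch T. is_character G chi \<and> chi \<noteq> (\<lambda>_. 0)) \<and>
     pairwise (\<lambda>chi \<zeta>. char_inner G chi \<zeta> = 0) (sch T) \<and>
     finite (sch T) \<and> card (scl T) = card (sch T) \<and>
     (\<forall>chi\<in>sch T. \<forall>K\<in>scl T. \<forall>g\<in>K. \<forall>h\<in>K. chi g = chi h)"

lemma superclass_basisD:
  assumes "superclass_basis G T"
  shows "partition_on (carrier G) (scl T)" "finite (sch T)" "card (scl T) = card (sch T)"
    and "chi \<in> sch T \<Longrightarrow> is_character G chi" "chi \<in> sch T \<Longrightarrow> chi \<noteq> (\<lambda>_. 0)"
    and "chi \<in> sch T \<Longrightarrow> \<zeta> \<in> sch T \<Longrightarrow> chi \<noteq> \<zeta> \<Longrightarrow> char_inner G chi \<zeta> = 0"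
    and "chi \<in> sch T \<Longrightarrow> K \<in> scl T \<Longrightarrow> g \<in> K \<Longrightarrow> h \<in> K \<Longrightarrow> chi g = chi h"
  using assms by (auto simp: superclass_basis_def pairwise_def)

lemma supercharacter_theory_basis: "supercharacter_theory G T \<Longrightarrow> superclass_basis G T"
  by (simp add: supercharacter_theory_def superclass_basis_def)

lemma superclass_eq:
  assumes "partition_on A (scl T)" "K \<in> scl T" "g \<in> K"
  shows "superclass T g = K"
  unfolding superclass_def
proof (rule the_equality)
  fix L assume "L \<in> scl T \<and> g \<in> L"
  then show "L = K" using partition_onD2[OF assms(1)] assms(2,3)
    by (auto simp: disjoint_def)
qed (use assms in auto)

lemma superclass_in:
  assumes "partition_on A (scl T)" "g \<in> A"
  shows "superclass T g \<in> scl T" "g \<in> superclass T g"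
proof -
  obtain K where "K \<in> scl T" "g \<in> K" using partition_onD1[OF assms(1)] assms(2) by auto
  then show "superclass T g \<in> scl T" "g \<in> superclass T g" using superclass_eq[OF assms(1)] by auto
qed

lemma sum_partition:
  assumes "finite A" "partition_on A P"
  shows "(\<Sum>g\<in>A. F g) = (\<Sum>K\<in>P. \<Sum>g\<in>K. F g)"
proof -
  have A: "A = \<Union>P" using assms(2) by (rule partition_onD1)
  have "(\<Sum>g\<in>\<Union>P. F g) = (\<Sum>K\<in>P. \<Sum>g\<in>K. F g)"
    using assms partition_onD2[OF assms(2)] A
    by (subst sum.Union_disjoint) (auto simp: disjoint_def intro: finite_subset[of _ A])
  then show ?thesis using A by simp
qed

lemma sum_class_function:
  fixes F :: "'a \<Rightarrow> complex"
  assumes "finite A" "partition_on A P"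
    and const: "\<And>K g h. K \<in> P \<Longrightarrow> g \<in> K \<Longrightarrow> h \<in> K \<Longrightarrow> F g = F h"
    and r: "\<And>K. K \<in> P \<Longrightarrow> r K \<in> K"
  shows "(\<Sum>g\<in>A. F g) = (\<Sum>K\<in>P. of_nat (card K) * F (r K))"
proof -
  have "(\<Sum>g\<in>K. F g) = of_nat (card K) * F (r K)" if "K \<in> P" for K
    using const[OF that] r[OF that] by (metis sum_constant sum.cong)
  then show ?thesis unfolding sum_partition[OF assms(1,2)] by simp
qed

text \<open>Orthogonality of the supercharacters says that the normalized character table times its
  weighted conjugate transpose is the identity. As there are as many superclasses as
  supercharacters, the product in the other order is the identity too; this column orthogonality is
  the expansion.\<close>

lemma superclass_function_expansion:
  assumes fin: "finite (carrier G)" and T: "superclass_basis G T"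
    and f: "\<And>K g h. K \<in> scl T \<Longrightarrow> g \<in> K \<Longrightarrow> h \<in> K \<Longrightarrow> f g = f h"
    and g: "g \<in> carrier G"
  shows "f g = (\<Sum>chi\<in>sch T. char_inner G f chi / char_inner G chi chi * chi g)"
proof -
  note [simp] = superclass_basisD(2)[OF T]
  note part = superclass_basisD(1)[OF T]
  let ?N = "of_nat (card (carrier G)) :: complex"
  have fscl: "finite (scl T)" using partition_onD1[OF part] fin by (metis finite_UnionD)
  define r where "r K = (SOME g. g \<in> K)" for K :: "'a set"
  have r: "r K \<in> K" if "K \<in> scl T" for K
    using partition_onD3[OF part] that unfolding r_def by (metis some_in_eq)
  \<comment> \<open>The normalization \<open>1 / char_inner G chi chi\<close> is put entirely into
    \<open>a\<close> and the weight of a superclass entirely into \<open>b\<close>. Then the sum of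
    \<open>a s K * b K s'\<close> over the superclasses is
    \<open>char_inner G s s' / char_inner G s s\<close>.\<close>
  define a where "a chi K = chi (r K) / char_inner G chi chi" for chi K
  define b where "b K chi = of_nat (card K) / ?N * cnj (chi (r K))" for chi K
  have inner: "char_inner G \<phi> chi = (\<Sum>K\<in>scl T. \<phi> (r K) * b K chi)"
    if "chi \<in> sch T" and \<phi>: "\<And>K g h. K \<in> scl T \<Longrightarrow> g \<in> K \<Longrightarrow> h \<in> K \<Longrightarrow> \<phi> g = \<phi> h" for \<phi> chi
  proof -
    have "(\<Sum>g\<in>carrier G. \<phi> g * cnj (chi g)) = (\<Sum>K\<in>scl T. of_nat (card K) * (\<phi> (r K) * cnj (chi (r K))))"
      using superclass_basisD(7)[OF T that(1)] \<phi> r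
      by (intro sum_class_function[OF fin part]) metis+
    then show ?thesis by (simp add: char_inner_def b_def sum_distrib_left mult_ac)
  qed
  have nz: "char_inner G chi chi \<noteq> 0" if "chi \<in> sch T" for chi
    using char_inner_self_nonzero[OF fin] superclass_basisD(4,5)[OF T that] by auto
  have swap: "(\<Sum>chi\<in>sch T. b K chi * a chi K') = (if K = K' then 1 else 0)"
    if "K \<in> scl T" "K' \<in> scl T" for K K'
  proof (rule biorthogonal_swap[of "sch T" "scl T" a b])
    fix s s' assume s: "s \<in> sch T" "s' \<in> sch T"
    have "char_inner G s s' = (\<Sum>K\<in>scl T. s (r K) * b K s')"
      by (rule inner[OF s(2)]) (rule superclass_basisD(7)[OF T s(1)])
    then have "(\<Sum>t\<in>scl T. a s t * b t s') = char_inner G s s' / char_inner G s s"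
      by (simp only: a_def sum_divide_distrib times_divide_eq_left)
    also have "\<dots> = (if s = s' then 1 else 0)"
      using nz[OF s(1)] superclass_basisD(6)[OF T s] by auto
    finally show "(\<Sum>t\<in>scl T. a s t * b t s') = (if s = s' then 1 else 0)" .
  qed (use fscl superclass_basisD(3)[OF T] that in auto)
  define K' where "K' = superclass T g"
  have K': "K' \<in> scl T" "g \<in> K'" using superclass_in[OF part g] by (auto simp: K'_def)
  have "(\<Sum>chi\<in>sch T. char_inner G f chi / char_inner G chi chi * chi g) =
      (\<Sum>chi\<in>sch T. (\<Sum>K\<in>scl T. f (r K) * b K chi) * a chi K')"
  proof (rule sum.cong[OF refl])
    fix chi assume chi: "chi \<in> sch T"
    have "chi g = chi (r K')" using superclass_basisD(7)[OF T chi K'(1,2) r[OF K'(1)]] .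
    then show "char_inner G f chi / char_inner G chi chi * chi g =
        (\<Sum>K\<in>scl T. f (r K) * b K chi) * a chi K'"
      using inner[OF chi f] by (simp add: a_def)
  qed
  also have "\<dots> = (\<Sum>K\<in>scl T. f (r K) * (\<Sum>chi\<in>sch T. b K chi * a chi K'))"
    by (simp only: sum_distrib_left sum_distrib_right mult.assoc) (rule sum.swap)
  also have "\<dots> = (\<Sum>K\<in>scl T. if K = K' then f (r K) else 0)"
    using swap K' by (intro sum.cong) auto
  also have "\<dots> = f (r K')" using fscl K' by simp
  also have "\<dots> = f g" using f[OF K'(1) r[OF K'(1)] K'(2)] .
  finally show ?thesis ..
qed

text \<open>An element of the superclass of the identity lies in the kernel of every supercharacter,
  hence of every irreducible character.\<close>
lemma superclass_one:
  assumes G: "group G" and fin: "finite (carrier G)" and T: "supercharacter_theory G T"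
  shows "superclass T \<one>\<^bsub>G\<^esub> = {\<one>\<^bsub>G\<^esub>}"
proof -
  interpret group G by fact
  note B = supercharacter_theory_basis[OF T]
  note part = superclass_basisD(1)[OF B]
  note sc = superclass_in[OF part one_closed]
  have "k = \<one>\<^bsub>G\<^esub>" if k: "k \<in> superclass T \<one>\<^bsub>G\<^esub>" for k
  proof (rule ccontr)
    assume ne: "k \<noteq> \<one>\<^bsub>G\<^esub>"
    have kc: "k \<in> carrier G" using k sc part by (auto dest: partition_onD1)
    obtain \<psi> where \<psi>: "irreducible_character G \<psi>" "Re (\<psi> k) < Re (\<psi> \<one>\<^bsub>G\<^esub>)"
      using irreducible_characters_separate_one[OF G fin kc ne] by blast
    have "\<exists>!chi. chi \<in> sch T \<and> constituent G \<psi> chi"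
      using T \<psi>(1) by (simp add: supercharacter_theory_def)
    then obtain chi where chi: "chi \<in> sch T" "constituent G \<psi> chi" by (elim ex1E) auto
    then obtain \<theta> where \<theta>: "is_character G \<theta>" "\<And>g. chi g = \<psi> g + \<theta> g"
      by (auto simp: constituent_def)
    have "chi k = chi \<one>\<^bsub>G\<^esub>" using superclass_basisD(7)[OF B chi(1) sc(1) k sc(2)] .
    \<comment> \<open>Constancy of \<open>chi\<close> gives equality only for the sum. Since
      \<open>\<theta>\<close> cannot exceed its degree either, it cannot compensate the loss of
      \<open>\<psi>\<close> at \<open>k\<close>.\<close>
    then have "Re (\<psi> k) + Re (\<theta> k) = Re (\<psi> \<one>\<^bsub>G\<^esub>) + Re (\<theta> \<one>\<^bsub>G\<^esub>)"
      using \<theta>(2) by (metis plus_complex.sel(1))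
    moreover have "Re (\<theta> k) \<le> Re (\<theta> \<one>\<^bsub>G\<^esub>)" using Re_character_le[OF G fin \<theta>(1) kc] .
    ultimately show False using \<psi>(2) by simp
  qed
  then show ?thesis using sc by auto
qed

section \<open>Superinduction and its adjointness to restriction\<close>

lemma SInd_superclass_const:
  assumes "partition_on (carrier G) (scl T)" "K \<in> scl T" "g \<in> K" "h \<in> K"
  shows "SInd G H T \<phi> g = SInd G H T \<phi> h"
  using assms partition_onD1[OF assms(1)] by (auto simp: SInd_def superclass_eq)

text \<open>On a superclass \<open>K\<close>, superinduction replaces the extension of
  \<open>\<phi>\<close> by zero by its average over \<open>K\<close>, times
  \<open>|G| / |H|\<close>. Summation against a function that is constant on \<open>K\<close> does
  not notice the averaging, and the factor \<open>|G| / |H|\<close> turns the normalization of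
  \<open>G\<close> into that of \<open>H\<close>.\<close>

lemma super_Frobenius_reciprocity:
  assumes fin: "finite (carrier G)" and H: "H \<subseteq> carrier G"
    and part: "partition_on (carrier G) (scl T)"
    and chi: "\<And>K g h. K \<in> scl T \<Longrightarrow> g \<in> K \<Longrightarrow> h \<in> K \<Longrightarrow> chi g = chi h"
  shows "char_inner G (SInd G H T \<phi>) chi = char_inner (G\<lparr>carrier := H\<rparr>) \<phi> chi"
proof (cases "carrier G = {}")
  case True
  then show ?thesis using H by (simp add: char_inner_def)
next
  case False
  let ?N = "of_nat (card (carrier G)) :: complex" and ?M = "of_nat (card H) :: complex"
  have N: "?N \<noteq> 0" using fin False by simp
  have K: "(\<Sum>g\<in>K. SInd G H T \<phi> g * cnj (chi g)) = ?N / ?M * (\<Sum>k\<in>K. (if k \<in> H then \<phi> k else 0) * cnj (chi k))"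
    if K: "K \<in> scl T" for K
  proof -
    have Kc: "K \<subseteq> carrier G" using K partition_onD1[OF part] by auto
    obtain x where x: "x \<in> K" using partition_onD3[OF part] K by (metis all_not_in_conv)
    have cK: "of_nat (card K) \<noteq> (0 :: complex)" using x finite_subset[OF Kc fin] by auto
    have "(\<Sum>g\<in>K. SInd G H T \<phi> g * cnj (chi g)) =
      (\<Sum>g\<in>K. ?N / (?M * of_nat (card K)) * (\<Sum>k\<in>K. if k \<in> H then \<phi> k else 0) * cnj (chi x))"
    proof (rule sum.cong[OF refl])
      fix g assume g: "g \<in> K"
      then show "SInd G H T \<phi> g * cnj (chi g) =
          ?N / (?M * of_nat (card K)) * (\<Sum>k\<in>K. if k \<in> H then \<phi> k else 0) * cnj (chi x)"
        using Kc superclass_eq[OF part K g] chi[OF K g x] by (auto simp: SInd_def)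
    qed
    also have "\<dots> = ?N / ?M * (\<Sum>k\<in>K. if k \<in> H then \<phi> k else 0) * cnj (chi x)"
      using cK by (simp add: field_simps)
    also have "\<dots> = ?N / ?M * (\<Sum>k\<in>K. (if k \<in> H then \<phi> k else 0) * cnj (chi k))"
      using chi[OF K _ x] by (simp add: sum_distrib_right mult.assoc)
    finally show ?thesis .
  qed
  have "(\<Sum>g\<in>carrier G. SInd G H T \<phi> g * cnj (chi g)) =
      ?N / ?M * (\<Sum>k\<in>carrier G. (if k \<in> H then \<phi> k else 0) * cnj (chi k))"
    unfolding sum_partition[OF fin part] by (simp add: K sum_distrib_left)
  also have "(\<Sum>k\<in>carrier G. (if k \<in> H then \<phi> k else 0) * cnj (chi k)) = (\<Sum>k\<in>H. \<phi> k * cnj (chi k))"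
    using H fin by (intro sum.mono_neutral_cong_right) auto
  finally show ?thesis using N by (simp add: char_inner_def)
qed

section \<open>Nonnegativity and sum formulas for the transition weights\<close>

lemma transition_nonneg:
  assumes G: "group G" and fin: "finite (carrier G)" and H: "subgroup H G"
    and T: "superclass_basis G T" and \<gamma>: "is_character (G\<lparr>carrier := H\<rparr>) \<gamma>" and chi: "chi \<in> sch T"
  shows "transition G H T \<gamma> chi \<in> \<real>\<^sub>\<ge>\<^sub>0"
proof -
  interpret group G by fact
  have Hc: "H \<subseteq> carrier G" using H by (rule subgroup.subset)
  have GH: "group (G\<lparr>carrier := H\<rparr>)" using H G by (rule subgroup.subgroup_is_group)
  note ch = superclass_basisD(4)[OF T chi]
  have "char_inner G (SInd G H T \<gamma>) chi = char_inner (G\<lparr>carrier := H\<rparr>) \<gamma> chi"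
    using super_Frobenius_reciprocity[OF fin Hc superclass_basisD(1)[OF T] superclass_basisD(7)[OF T chi]] .
  \<comment> \<open>The scalar product over \<open>H\<close> sees only values on \<open>H\<close>.
    Cutting \<open>chi\<close> off outside \<open>H\<close> turns it into a character of the
    subgroup, which by convention vanishes outside its carrier.\<close>
  also have "\<dots> = char_inner (G\<lparr>carrier := H\<rparr>) \<gamma> (\<lambda>h. if h \<in> H then chi h else 0)"
    by (simp add: char_inner_def)
  also have "\<dots> \<in> \<real>\<^sub>\<ge>\<^sub>0"
    using finite_subset[OF Hc fin] character_subgroup[OF H ch] \<gamma> by (intro char_inner_nonneg[OF GH]) auto
  finally have "char_inner G (SInd G H T \<gamma>) chi \<in> \<real>\<^sub>\<ge>\<^sub>0" .
  moreover have "\<gamma> \<one>\<^bsub>G\<^esub> \<in> \<real>\<^sub>\<ge>\<^sub>0" using character_one_nonneg[OF GH \<gamma>] by simp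
  ultimately show ?thesis
    unfolding transition_def
    using character_one_nonneg[OF G ch] char_inner_nonneg[OF G fin ch ch]
    by (intro nonneg_Reals_mult_I nonneg_Reals_divide_I) auto
qed

theorem sum_transition_SPl:
  assumes G: "group G" and fin: "finite (carrier G)" and H: "subgroup H G"
    and TG: "superclass_basis G TG" and TH: "superclass_basis (G\<lparr>carrier := H\<rparr>) TH"
    and con: "consistent TH TG" and chi: "chi \<in> sch TG"
  shows "(\<Sum>\<gamma>\<in>sch TH. transition G H TG \<gamma> chi * SPl (G\<lparr>carrier := H\<rparr>) \<gamma>) = SPl G chi"
proof -
  interpret group G by fact
  let ?H = "G\<lparr>carrier := H\<rparr>"
  have Hc: "H \<subseteq> carrier G" using H by (rule subgroup.subset)
  have finH: "finite (carrier ?H)" using finite_subset[OF Hc fin] by simp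
  have oneH: "\<one>\<^bsub>G\<^esub> \<in> H" using H by (rule subgroup.one_closed)
  have cH: "of_nat (card H) \<noteq> (0 :: complex)" using oneH finH by auto
  have GH: "group ?H" using H G by (rule subgroup.subgroup_is_group)
  note ch = superclass_basisD(4)[OF TG chi]
  have real: "cnj z = z" if "z \<in> \<real>\<^sub>\<ge>\<^sub>0" for z
    using that by (metis Reals_cnj_iff nonneg_Reals_subset_Reals subsetD)
  \<comment> \<open>What remains of the weights once \<open>|H|\<close> and one factor
    \<open>\<gamma>(1)\<close> have cancelled. Reciprocity yields the scalar product of
    \<open>\<gamma>\<close> with \<open>chi\<close>, while the expansion of \<open>chi\<close> needs
    the reverse order; hence the conjugate, under which the degrees and norms are unchanged because
    they are real.\<close>
  let ?c = "chi \<one>\<^bsub>G\<^esub> / (of_nat (card (carrier G)) * char_inner G chi chi)"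
  have "(\<Sum>\<gamma>\<in>sch TH. transition G H TG \<gamma> chi * SPl ?H \<gamma>) =
      (\<Sum>\<gamma>\<in>sch TH. ?c * cnj (char_inner ?H chi \<gamma> / char_inner ?H \<gamma> \<gamma> * \<gamma> \<one>\<^bsub>G\<^esub>))"
  proof (rule sum.cong[OF refl])
    fix \<gamma> assume g: "\<gamma> \<in> sch TH"
    note \<gamma> = superclass_basisD(4)[OF TH g]
    have g1: "\<gamma> \<one>\<^bsub>G\<^esub> \<noteq> 0"
      using character_one_nonzero[OF GH \<gamma>] superclass_basisD(5)[OF TH g] by simp
    have "cnj (char_inner ?H \<gamma> \<gamma>) = char_inner ?H \<gamma> \<gamma>" "cnj (\<gamma> \<one>\<^bsub>G\<^esub>) = \<gamma> \<one>\<^bsub>G\<^esub>"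
      using real[OF char_inner_nonneg[OF GH finH \<gamma> \<gamma>]] real[OF character_one_nonneg[OF GH \<gamma>]] by auto
    moreover have "char_inner G (SInd G H TG \<gamma>) chi = cnj (char_inner ?H chi \<gamma>)"
      using super_Frobenius_reciprocity[OF fin Hc superclass_basisD(1)[OF TG] superclass_basisD(7)[OF TG chi]]
        char_inner_cnj[of ?H \<gamma> chi] by simp
    ultimately show "transition G H TG \<gamma> chi * SPl ?H \<gamma> =
        ?c * cnj (char_inner ?H chi \<gamma> / char_inner ?H \<gamma> \<gamma> * \<gamma> \<one>\<^bsub>G\<^esub>)"
      using g1 cH by (simp add: transition_def SPl_def power2_eq_square)
  qed
  also have "\<dots> = ?c * cnj (\<Sum>\<gamma>\<in>sch TH. char_inner ?H chi \<gamma> / char_inner ?H \<gamma> \<gamma> * \<gamma> \<one>\<^bsub>G\<^esub>)"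
    by (simp only: cnj_sum sum_distrib_left)
  also have "(\<Sum>\<gamma>\<in>sch TH. char_inner ?H chi \<gamma> / char_inner ?H \<gamma> \<gamma> * \<gamma> \<one>\<^bsub>G\<^esub>) = chi \<one>\<^bsub>G\<^esub>"
  proof (rule superclass_function_expansion[OF finH TH, symmetric])
    \<comment> \<open>Consistency enters here: a superclass \<open>L\<close> of the subgroup lies
      inside one superclass of \<open>G\<close>, so \<open>chi\<close> is constant on it.\<close>
    fix L g h assume "L \<in> scl TH" "g \<in> L" "h \<in> L"
    then show "chi g = chi h"
      using con superclass_basisD(7)[OF TG chi] unfolding consistent_def by (meson subsetD)
  qed (use oneH in auto)
  also have "cnj (chi \<one>\<^bsub>G\<^esub>) = chi \<one>\<^bsub>G\<^esub>" using real[OF character_one_nonneg[OF G ch]] .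
  finally show ?thesis by (simp add: SPl_def power2_eq_square)
qed

theorem sum_transition_eq_1:
  assumes G: "group G" and fin: "finite (carrier G)" and H: "subgroup H G"
    and TG: "supercharacter_theory G TG"
    and \<gamma>: "is_character (G\<lparr>carrier := H\<rparr>) \<gamma>" "\<gamma> \<noteq> (\<lambda>_. 0)"
  shows "(\<Sum>chi\<in>sch TG. transition G H TG \<gamma> chi) = 1"
proof -
  interpret group G by fact
  note B = supercharacter_theory_basis[OF TG]
  have Hc: "H \<subseteq> carrier G" using H by (rule subgroup.subset)
  have oneH: "\<one>\<^bsub>G\<^esub> \<in> H" using H by (rule subgroup.one_closed)
  have cH: "of_nat (card H) \<noteq> (0 :: complex)" using oneH finite_subset[OF Hc fin] by auto
  have cG: "of_nat (card (carrier G)) \<noteq> (0 :: complex)" using fin by auto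
  have g1: "\<gamma> \<one>\<^bsub>G\<^esub> \<noteq> 0"
    using character_one_nonzero[OF subgroup.subgroup_is_group[OF H G] \<gamma>] by simp
  \<comment> \<open>The reciprocal of the value of \<open>SInd G H TG \<gamma>\<close> at the
    identity.\<close>
  let ?c = "of_nat (card H) / (of_nat (card (carrier G)) * \<gamma> \<one>\<^bsub>G\<^esub>)"
  have "(\<Sum>chi\<in>sch TG. transition G H TG \<gamma> chi) =
      ?c * (\<Sum>chi\<in>sch TG. char_inner G (SInd G H TG \<gamma>) chi / char_inner G chi chi * chi \<one>\<^bsub>G\<^esub>)"
    by (simp add: transition_def sum_distrib_left mult_ac)
  also have "(\<Sum>chi\<in>sch TG. char_inner G (SInd G H TG \<gamma>) chi / char_inner G chi chi * chi \<one>\<^bsub>G\<^esub>)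
      = SInd G H TG \<gamma> \<one>\<^bsub>G\<^esub>"
    by (rule superclass_function_expansion[OF fin B, symmetric])
      (erule (2) SInd_superclass_const[OF superclass_basisD(1)[OF B]], simp)
  also have "\<dots> = of_nat (card (carrier G)) / of_nat (card H) * \<gamma> \<one>\<^bsub>G\<^esub>"
    using oneH by (simp add: SInd_def superclass_one[OF G fin TG])
  finally show ?thesis using cG cH g1 by simp
qed

section \<open>Markov chains on finite state spaces\<close>

text \<open>Passes to the canonical version: the law of the trajectories, with the coordinates as
  process. It moves a process from whatever sample space it was built on to the space of sequences
  of states.\<close>

lemma markov_process_distr:
  fixes S :: "nat \<Rightarrow> 's set"
  assumes mp: "markov_process P X S s0 p"
  shows "\<exists>(M :: (nat \<Rightarrow> 's) measure) Y. markov_process M Y S s0 p"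
proof -
  have X: "X n \<in> measurable P (count_space (S n))" for n
    using mp by (auto simp: markov_process_def)
  interpret P: prob_space P using mp by (simp add: markov_process_def)
  let ?N = "Pi\<^sub>M UNIV (\<lambda>n. count_space (S n))"
  define X' where "X' \<omega> n = X n \<omega>" for \<omega> n
  have X': "X' \<in> measurable P ?N"
    unfolding X'_def[abs_def] by (rule measurable_abs_UNIV) (rule X)
  define M where "M = distr P ?N X'"
  have Mspace: "space M = space ?N" and Msets: "sets M = sets ?N" by (simp_all add: M_def)
  have Y: "(\<lambda>w. w n) \<in> measurable M (count_space (S n))" for n
    unfolding M_def measurable_distr_eq1 by (rule measurable_component_singleton) simp
  have eqs: "{w \<in> space ?N. w i = a} \<in> sets ?N" for i a
  proof -
    \<comment> \<open>The point \<open>a\<close> may lie outside \<open>S i\<close>; intersecting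
      with \<open>S i\<close> keeps the set measurable in the count space and leaves the preimage
      unchanged.\<close>
    have "(\<lambda>w. w i) -` ({a} \<inter> S i) \<inter> space ?N \<in> sets ?N"
      by (rule measurable_sets[OF measurable_component_singleton[of i UNIV]]) auto
    also have "(\<lambda>w. w i) -` ({a} \<inter> S i) \<inter> space ?N = {w \<in> space ?N. w i = a}"
      by (auto simp: space_PiM)
    finally show ?thesis .
  qed
  have path: "{w \<in> space ?N. \<forall>i\<le>n. w i = x i} \<in> sets ?N" for n x
    using sets.sets_Collect_finite_All'[of "{..n}" ?N "\<lambda>i w. w i = x i"] eqs by simp
  have path': "{w \<in> space ?N. w (Suc n) = a \<and> (\<forall>i\<le>n. w i = x i)} \<in> sets ?N" for n x a
    using eqs path by (intro sets.sets_Collect_conj) auto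
  have prob: "\<P>(w in M. A w) = \<P>(\<omega> in P. A (X' \<omega>))" if "{w \<in> space ?N. A w} \<in> sets ?N" for A
  proof -
    have "X' -` {w \<in> space ?N. A w} \<inter> space P = {\<omega> \<in> space P. A (X' \<omega>)}"
      using measurable_space[OF X'] by auto
    then show ?thesis using measure_distr[OF X' that] by (simp add: M_def Mspace)
  qed
  have "markov_process M (\<lambda>n w. w n) S s0 p"
    unfolding markov_process_def
  proof (intro conjI allI impI Y)
    show "prob_space M" unfolding M_def by (rule P.prob_space_distr[OF X'])
    show "AE w in M. w 0 = s0"
      using mp unfolding M_def AE_distr_iff[OF X' eqs] by (simp add: markov_process_def X'_def)
  next
    fix n x assume "\<forall>i\<le>Suc n. x i \<in> S i" "0 < \<P>(w in M. \<forall>i\<le>n. w i = x i)"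
    then show "complex_of_real (\<P>(w in M. w (Suc n) = x (Suc n) \<bar> \<forall>i\<le>n. w i = x i)) = p n (x n) (x (Suc n))"
      using mp by (simp add: markov_process_def cond_prob_def prob[OF path] prob[OF path'] X'_def)
  qed
  then show ?thesis by blast
qed

text \<open>For every time \<open>n\<close> and state \<open>s\<close> a successor \<open>\<omega> (n, s)\<close> is drawn, all draws being independent;
  the process follows these successors.\<close>
lemma markov_process_exists:
  fixes S :: "nat \<Rightarrow> 's set" and p :: "nat \<Rightarrow> 's \<Rightarrow> 's \<Rightarrow> complex"
  assumes fin: "\<And>n. finite (S n)" and s0: "s0 \<in> S 0"
    and nonneg: "\<And>n s t. s \<in> S n \<Longrightarrow> t \<in> S (Suc n) \<Longrightarrow> p n s t \<in> \<real>\<^sub>\<ge>\<^sub>0"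
    and row: "\<And>n s. s \<in> S n \<Longrightarrow> (\<Sum>t\<in>S (Suc n). p n s t) = 1"
  shows "\<exists>(M :: (nat \<Rightarrow> 's) measure) Y. markov_process M Y S s0 p"
proof -
  \<comment> \<open>Draws are indexed by pairs of a time and an admissible state, since it is at
    these states that the weights are known to form a probability distribution.\<close>
  define I where "I = (SIGMA n:UNIV. S n)"
  define K where "K = (\<lambda>(n, s). point_measure (S (Suc n)) (\<lambda>t. ennreal (Re (p n s t))))"
  have nn: "0 \<le> Re (p n s t)" "complex_of_real (Re (p n s t)) = p n s t"
    if "s \<in> S n" "t \<in> S (Suc n)" for n s t
    using nonneg[OF that] by (auto simp: complex_nonneg_Reals_iff complex_eq_iff)
  have Ks [simp]: "space (K (n, s)) = S (Suc n)" "sets (K (n, s)) = Pow (S (Suc n))" for n s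
    by (simp_all add: K_def space_point_measure sets_point_measure)
  have pK: "prob_space (K i)" if iI: "i \<in> I" for i
  proof (rule prob_spaceI)
    obtain n s where i: "i = (n, s)" "s \<in> S n" using iI by (cases i) (auto simp: I_def)
    have "emeasure (K i) (space (K i)) = (\<Sum>t\<in>S (Suc n). ennreal (Re (p n s t)))"
      using fin by (simp add: i K_def emeasure_point_measure_finite space_point_measure)
    also have "\<dots> = ennreal (Re (\<Sum>t\<in>S (Suc n). p n s t))"
      using nn i by (simp add: sum_ennreal)
    finally show "emeasure (K i) (space (K i)) = 1" using row[OF i(2)] by simp
  qed
  define P where "P = PiM I K"
  interpret prob_space P unfolding P_def using pK by (rule prob_space_PiM)
  define X where "X n \<omega> = rec_nat s0 (\<lambda>n s. \<omega> (n, s)) n" for n and \<omega> :: "nat \<times> 's \<Rightarrow> 's"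
  have X0 [simp]: "X 0 \<omega> = s0" and XSuc [simp]: "X (Suc n) \<omega> = \<omega> (n, X n \<omega>)" for n \<omega>
    by (simp_all add: X_def)
  have XS: "X n \<omega> \<in> S n" if "\<omega> \<in> space P" for n \<omega>
  proof (induction n)
    case (Suc n)
    then have "(n, X n \<omega>) \<in> I" by (simp add: I_def)
    then have "\<omega> (n, X n \<omega>) \<in> space (K (n, X n \<omega>))"
      using that PiE_mem[of \<omega> I "\<lambda>i. space (K i)"] by (simp only: P_def space_PiM)
    then show ?case by simp
  qed (simp add: s0)
  have draw: "{\<omega> \<in> space P. \<omega> (n, s) = t} \<in> sets P" if "s \<in> S n" for n s t
  proof -
    have "(\<lambda>\<omega>. \<omega> (n, s)) -` ({t} \<inter> S (Suc n)) \<inter> space P \<in> sets P"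
      unfolding P_def using that
      by (intro measurable_sets[OF measurable_component_singleton[of "(n, s)" I]]) (auto simp: I_def)
    also have "(\<lambda>\<omega>. \<omega> (n, s)) -` ({t} \<inter> S (Suc n)) \<inter> space P = {\<omega> \<in> space P. \<omega> (n, s) = t}"
    proof -
      have "\<omega> (n, s) \<in> S (Suc n)" if "\<omega> \<in> space P" for \<omega>
        using that \<open>s \<in> S n\<close> PiE_mem[of \<omega> I "\<lambda>i. space (K i)" "(n, s)"] by (simp add: P_def space_PiM I_def)
      then show ?thesis by auto
    qed
    finally show ?thesis .
  qed
  have Xm: "{\<omega> \<in> space P. X n \<omega> = t} \<in> sets P" for n t
  proof (induction n arbitrary: t)
    case 0
    then show ?case by (cases "s0 = t") auto
  next
    case (Suc n)
    \<comment> \<open>The coordinate read at time \<open>Suc n\<close> depends on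
      \<open>\<omega>\<close> through \<open>X n \<omega>\<close>. Splitting by the finitely many
      values of \<open>X n\<close> leaves a fixed coordinate in each piece.\<close>
    have "{\<omega> \<in> space P. X (Suc n) \<omega> = t} =
        (\<Union>s\<in>S n. {\<omega> \<in> space P. X n \<omega> = s} \<inter> {\<omega> \<in> space P. \<omega> (n, s) = t})"
      using XS by auto
    also have "\<dots> \<in> sets P" using Suc draw fin by (intro sets.finite_UN sets.Int) auto
    finally show ?case .
  qed
  have Xmeas: "X n \<in> measurable P (count_space (S n))" for n
  proof -
    have "X n -` {a} \<inter> space P = {\<omega> \<in> space P. X n \<omega> = a}" for a by auto
    then show ?thesis using XS Xm by (auto simp: measurable_count_space_eq2[OF fin])
  qed
  have path: "\<P>(\<omega> in P. \<forall>i\<le>n. X i \<omega> = x i) =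
      (if x 0 = s0 then \<Prod>i<n. Re (p i (x i) (x (Suc i))) else 0)"
    if x: "\<And>i. i \<le> n \<Longrightarrow> x i \<in> S i" for n x
  proof (cases "x 0 = s0")
    case False
    then have none: "{\<omega> \<in> space P. \<forall>i\<le>n. X i \<omega> = x i} = {}" by force
    show ?thesis unfolding none using False by simp
  next
    case True
    \<comment> \<open>Along a prescribed path the process reads the coordinates
      \<open>(i, x i)\<close>. They are pairwise distinct because the times are, so the path event
      is a cylinder and independence turns its probability into a product.\<close>
    let ?J = "(\<lambda>i. (i, x i)) ` {..<n}"
    have follow: "(\<forall>i\<le>n. X i \<omega> = x i) \<longleftrightarrow> (\<forall>i<n. \<omega> (i, x i) = x (Suc i))" for \<omega>
    proof
      assume *: "\<forall>i\<le>n. X i \<omega> = x i"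
      show "\<forall>i<n. \<omega> (i, x i) = x (Suc i)"
      proof (intro allI impI)
        fix i assume "i < n"
        then have "X i \<omega> = x i" "X (Suc i) \<omega> = x (Suc i)" using * by (auto simp del: XSuc)
        then show "\<omega> (i, x i) = x (Suc i)" by simp
      qed
    next
      assume *: "\<forall>i<n. \<omega> (i, x i) = x (Suc i)"
      have "i \<le> n \<longrightarrow> X i \<omega> = x i" for i
        by (induction i) (use * True in auto)
      then show "\<forall>i\<le>n. X i \<omega> = x i" by blast
    qed
    have J: "?J \<subseteq> I" using x by (auto simp: I_def)
    have "{\<omega> \<in> space P. \<forall>i\<le>n. X i \<omega> = x i} =
        prod_emb I K ?J (Pi\<^sub>E ?J (\<lambda>j. {x (Suc (fst j))}))"
      unfolding follow using J by (auto simp: prod_emb_def P_def space_PiM PiE_iff extensional_def)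
    moreover have "emeasure P (prod_emb I K ?J (Pi\<^sub>E ?J (\<lambda>j. {x (Suc (fst j))}))) =
        (\<Prod>j\<in>?J. emeasure (K j) {x (Suc (fst j))})"
      unfolding P_def using pK J x by (intro emeasure_PiM_emb) auto
    moreover have "\<dots> = (\<Prod>i<n. emeasure (K (i, x i)) {x (Suc i)})"
      by (subst prod.reindex) (auto simp: inj_on_def)
    moreover have "\<dots> = (\<Prod>i<n. ennreal (Re (p i (x i) (x (Suc i)))))"
      using x fin by (intro prod.cong) (auto simp: K_def emeasure_point_measure_finite)
    moreover have "\<dots> = ennreal (\<Prod>i<n. Re (p i (x i) (x (Suc i))))"
      using nn(1) x by (intro prod_ennreal) auto
    moreover have "0 \<le> (\<Prod>i<n. Re (p i (x i) (x (Suc i))))"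
      using nn(1) x by (intro prod_nonneg) auto
    ultimately show ?thesis using True by (simp add: measure_def)
  qed
  have "markov_process P X S s0 p"
    unfolding markov_process_def
  proof (intro conjI allI impI Xmeas)
    show "prob_space P" by unfold_locales
    show "AE \<omega> in P. X 0 \<omega> = s0" by simp
  next
    fix n x assume x: "\<forall>i\<le>Suc n. x i \<in> S i" and pos: "0 < \<P>(\<omega> in P. \<forall>i\<le>n. X i \<omega> = x i)"
    have "(X (Suc n) \<omega> = x (Suc n) \<and> (\<forall>i\<le>n. X i \<omega> = x i)) \<longleftrightarrow> (\<forall>i\<le>Suc n. X i \<omega> = x i)" for \<omega>
      by (auto simp: le_Suc_eq simp del: XSuc)
    then have "\<P>(\<omega> in P. X (Suc n) \<omega> = x (Suc n) \<bar> \<forall>i\<le>n. X i \<omega> = x i) =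
        \<P>(\<omega> in P. \<forall>i\<le>Suc n. X i \<omega> = x i) / \<P>(\<omega> in P. \<forall>i\<le>n. X i \<omega> = x i)"
      by (simp only: cond_prob_def)
    also have "\<dots> = Re (p n (x n) (x (Suc n)))"
    proof -
      define q where "q = (\<Prod>i<n. Re (p i (x i) (x (Suc i))))"
      have "\<P>(\<omega> in P. \<forall>i\<le>n. X i \<omega> = x i) = (if x 0 = s0 then q else 0)"
        unfolding q_def by (rule path) (use x in auto)
      moreover have "\<P>(\<omega> in P. \<forall>i\<le>Suc n. X i \<omega> = x i) =
          (if x 0 = s0 then q * Re (p n (x n) (x (Suc n))) else 0)"
        using path[of "Suc n" x] x by (simp add: q_def del: XSuc)
      \<comment> \<open>A positive probability of the history forces \<open>x 0 = s0\<close> and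
        \<open>q \<noteq> 0\<close>, so \<open>q\<close> cancels in the quotient.\<close>
      ultimately show ?thesis using pos by (simp split: if_splits del: XSuc)
    qed
    finally show "complex_of_real (\<P>(\<omega> in P. X (Suc n) \<omega> = x (Suc n) \<bar> \<forall>i\<le>n. X i \<omega> = x i)) =
        p n (x n) (x (Suc n))"
      using nn(2) x by simp
  qed
  then show ?thesis by (rule markov_process_distr)
qed

text \<open>The defining property conditions on the whole history, not on the last state. The event
  is therefore decomposed into all finite histories, and these are then grouped by their last state.
  The argument applies to every process with the given weights, whatever its sample space.\<close>

lemma markov_process_marginal_Suc:
  assumes mp: "markov_process M Y S s0 p" and fin: "\<And>n. finite (S n)" and t: "t \<in> S (Suc n)"
  shows "complex_of_real (\<P>(\<omega> in M. Y (Suc n) \<omega> = t)) =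
    (\<Sum>s\<in>S n. complex_of_real (\<P>(\<omega> in M. Y n \<omega> = s)) * p n s t)"
proof -
  interpret prob_space M using mp by (simp add: markov_process_def)
  have Y [measurable]: "Y k \<in> measurable M (count_space (S k))" for k
    using mp by (simp add: markov_process_def)
  have YS: "Y k \<omega> \<in> S k" if "\<omega> \<in> space M" for k \<omega>
    using measurable_space[OF Y that] by simp
  have ev: "{\<omega> \<in> space M. Y k \<omega> = s} \<in> events" for k s
  proof -
    have "Y k -` ({s} \<inter> S k) \<inter> space M \<in> events" by (rule measurable_sets[OF Y]) auto
    also have "Y k -` ({s} \<inter> S k) \<inter> space M = {\<omega> \<in> space M. Y k \<omega> = s}" using YS by auto
    finally show ?thesis .
  qed
  have path: "{\<omega> \<in> space M. \<forall>i\<le>n. Y i \<omega> = x i} \<in> events" for x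
    using sets.sets_Collect_finite_All'[of "{..n}" M "\<lambda>i \<omega>. Y i \<omega> = x i"] ev by simp
  \<comment> \<open>Histories are extensional functions, so that each sample point follows exactly
    one of them.\<close>
  define X where "X = Pi\<^sub>E {..n} S"
  have finX: "finite X" unfolding X_def using fin by (intro finite_PiE) auto
  have uniq: "\<exists>!x\<in>X. \<forall>i\<le>n. Y i \<omega> = x i" if w: "\<omega> \<in> space M" for \<omega>
  proof (rule ex1I[of _ "restrict (\<lambda>i. Y i \<omega>) {..n}"])
    fix x assume "x \<in> X \<and> (\<forall>i\<le>n. Y i \<omega> = x i)"
    then show "x = restrict (\<lambda>i. Y i \<omega>) {..n}"
      by (intro ext) (auto simp: X_def PiE_def extensional_def)
  qed (use YS[OF w] in \<open>auto simp: X_def\<close>)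
  have step: "complex_of_real (\<P>(\<omega> in M. Y (Suc n) \<omega> = t \<and> (\<forall>i\<le>n. Y i \<omega> = x i))) =
      complex_of_real (\<P>(\<omega> in M. \<forall>i\<le>n. Y i \<omega> = x i)) * p n (x n) t" if x: "x \<in> X" for x
  proof (cases "\<P>(\<omega> in M. \<forall>i\<le>n. Y i \<omega> = x i) > 0")
    case True
    \<comment> \<open>The Markov property quantifies over paths up to time \<open>Suc n\<close>,
      whereas \<open>x\<close> is \<open>undefined\<close> there; the target state \<open>t\<close>
      is filled in.\<close>
    define x' where "x' = x(Suc n := t)"
    have x': "(\<forall>i\<le>n. Y i \<omega> = x' i) \<longleftrightarrow> (\<forall>i\<le>n. Y i \<omega> = x i)" for \<omega> by (auto simp: x'_def)
    have "\<forall>i\<le>Suc n. x' i \<in> S i" using x t by (auto simp: x'_def X_def le_Suc_eq)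
    moreover have "0 < \<P>(\<omega> in M. \<forall>i\<le>n. Y i \<omega> = x' i)" using True by (simp only: x')
    ultimately have "complex_of_real (\<P>(\<omega> in M. Y (Suc n) \<omega> = x' (Suc n) \<bar> \<forall>i\<le>n. Y i \<omega> = x' i)) =
        p n (x' n) (x' (Suc n))"
      using mp unfolding markov_process_def by blast
    then have "complex_of_real (\<P>(\<omega> in M. Y (Suc n) \<omega> = t \<bar> \<forall>i\<le>n. Y i \<omega> = x i)) = p n (x n) t"
      unfolding x' by (simp add: x'_def)
    then show ?thesis using True by (simp add: cond_prob_def field_simps)
  next
    case False
    \<comment> \<open>A history of probability 0 carries no information about \<open>p\<close>, but
      then both sides are 0.\<close>
    then have 0: "\<P>(\<omega> in M. \<forall>i\<le>n. Y i \<omega> = x i) = 0" using measure_nonneg[of M] by (simp add: not_less antisym)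
    have "\<P>(\<omega> in M. Y (Suc n) \<omega> = t \<and> (\<forall>i\<le>n. Y i \<omega> = x i)) \<le> \<P>(\<omega> in M. \<forall>i\<le>n. Y i \<omega> = x i)"
      using path by (intro finite_measure_mono) auto
    then show ?thesis using 0 measure_nonneg[of M] by (simp add: antisym)
  qed
  have total: "\<P>(\<omega> in M. Y (Suc n) \<omega> = t) = (\<Sum>x\<in>X. \<P>(\<omega> in M. Y (Suc n) \<omega> = t \<and> (\<forall>i\<le>n. Y i \<omega> = x i)))"
    using uniq by (intro prob_sum[OF finX] sets.sets_Collect_conj ev path AE_I2) blast
  have margin: "\<P>(\<omega> in M. Y n \<omega> = s) = (\<Sum>x\<in>{x\<in>X. x n = s}. \<P>(\<omega> in M. \<forall>i\<le>n. Y i \<omega> = x i))" for s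
  proof (rule prob_sum)
    show "AE \<omega> in M. (\<forall>x\<in>{x \<in> X. x n = s}. (\<forall>i\<le>n. Y i \<omega> = x i) \<longrightarrow> Y n \<omega> = s) \<and>
      (Y n \<omega> = s \<longrightarrow> (\<exists>!x\<in>{x \<in> X. x n = s}. \<forall>i\<le>n. Y i \<omega> = x i))"
    proof (rule AE_I2, intro conjI ballI impI)
      fix \<omega> x assume "x \<in> {x \<in> X. x n = s}" "\<forall>i\<le>n. Y i \<omega> = x i"
      then show "Y n \<omega> = s" by simp
    next
      fix \<omega> assume w: "\<omega> \<in> space M" and s: "Y n \<omega> = s"
      obtain x where x: "x \<in> X" "\<forall>i\<le>n. Y i \<omega> = x i"
        and u: "\<And>y. y \<in> X \<Longrightarrow> \<forall>i\<le>n. Y i \<omega> = y i \<Longrightarrow> y = x"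
        using uniq[OF w] by blast
      show "\<exists>!x\<in>{x \<in> X. x n = s}. \<forall>i\<le>n. Y i \<omega> = x i"
      proof (rule ex1I[of _ x])
        show "x \<in> {x \<in> X. x n = s} \<and> (\<forall>i\<le>n. Y i \<omega> = x i)" using x s by auto
        show "y = x" if "y \<in> {x \<in> X. x n = s} \<and> (\<forall>i\<le>n. Y i \<omega> = y i)" for y
          using that by (intro u) auto
      qed
    qed
  qed (use finX path ev in auto)
  have "complex_of_real (\<P>(\<omega> in M. Y (Suc n) \<omega> = t)) =
      (\<Sum>x\<in>X. complex_of_real (\<P>(\<omega> in M. \<forall>i\<le>n. Y i \<omega> = x i)) * p n (x n) t)"
    unfolding total of_real_sum using step by (intro sum.cong) auto
  also have "\<dots> = (\<Sum>s\<in>S n. \<Sum>x\<in>{x\<in>X. x n = s}. complex_of_real (\<P>(\<omega> in M. \<forall>i\<le>n. Y i \<omega> = x i)) * p n (x n) t)"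
    by (rule sum.group[OF finX fin, symmetric]) (auto simp: X_def)
  also have "\<dots> = (\<Sum>s\<in>S n. complex_of_real (\<P>(\<omega> in M. Y n \<omega> = s)) * p n s t)"
    unfolding margin of_real_sum sum_distrib_right by (intro sum.cong) auto
  finally show ?thesis .
qed

section \<open>Embedded theories and towers\<close>

lemma embed_fun_apply:
  "inj_on f A \<Longrightarrow> x \<in> A \<Longrightarrow> embed_fun f A \<phi> (f x) = \<phi> x"
  by (simp add: embed_fun_def)

lemma embed_character:
  assumes A: "group A" and B: "group B" and f: "f \<in> mon A B" and chi: "is_character A chi"
  shows "is_character (B\<lparr>carrier := f ` carrier A\<rparr>) (embed_fun f (carrier A) chi)"
proof -
  interpret A: group A by fact
  interpret B: group B by fact
  have hom: "f \<in> hom A B" and inj: "inj_on f (carrier A)" using f by (auto simp: mon_def)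
  from chi obtain n R where R: "is_rep A n R" "affords A n R chi"
    by (auto simp: is_character_def)
  define R' where "R' h = R (inv_into (carrier A) f h)" for h
  have R': "R' (f x) = R x" if "x \<in> carrier A" for x using that inj by (simp add: R'_def)
  have one: "f \<one>\<^bsub>A\<^esub> = \<one>\<^bsub>B\<^esub>" using hom_one[OF hom A B] .
  have mult: "f x \<otimes>\<^bsub>B\<^esub> f y = f (x \<otimes>\<^bsub>A\<^esub> y)" if "x \<in> carrier A" "y \<in> carrier A" for x y
    using hom_mult[OF hom that] by simp
  have "R' \<one>\<^bsub>B\<^esub> = 1\<^sub>m n" using R' one R(1) by (metis A.one_closed is_rep_def)
  then have "is_rep (B\<lparr>carrier := f ` carrier A\<rparr>) n R'"
    using R(1) by (auto simp: is_rep_def R' mult)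
  moreover have "affords (B\<lparr>carrier := f ` carrier A\<rparr>) n R' (embed_fun f (carrier A) chi)"
    using R(2) inj by (auto simp: affords_def embed_fun_def R')
  ultimately show ?thesis by (auto simp: is_character_def)
qed

lemma embed_char_inner:
  assumes "inj_on f (carrier A)"
  shows "char_inner (B\<lparr>carrier := f ` carrier A\<rparr>) (embed_fun f (carrier A) \<phi>) (embed_fun f (carrier A) \<psi>)
    = char_inner A \<phi> \<psi>"
  using assms by (simp add: char_inner_def card_image sum.reindex embed_fun_apply)

lemma embed_SPl:
  assumes "group A" "group B" "f \<in> mon A B"
  shows "SPl (B\<lparr>carrier := f ` carrier A\<rparr>) (embed_fun f (carrier A) \<phi>) = SPl A \<phi>"
proof -
  have hom: "f \<in> hom A B" and inj: "inj_on f (carrier A)" using assms(3) by (auto simp: mon_def)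
  have "embed_fun f (carrier A) \<phi> \<one>\<^bsub>B\<^esub> = \<phi> \<one>\<^bsub>A\<^esub>"
    using embed_fun_apply[OF inj, of "\<one>\<^bsub>A\<^esub>"] hom_one[OF hom assms(1,2)] assms(1)
    by (simp add: group.is_monoid)
  then show ?thesis using inj by (simp add: SPl_def embed_char_inner card_image)
qed

text \<open>\<open>embed_fun\<close> forgets the values outside the carrier; for characters these
  are all 0. Injectivity preserves the number of supercharacters and allows sums over embedded
  supercharacters to be pulled back.\<close>

lemma embed_fun_inj_on:
  assumes "inj_on f (carrier A)" "\<And>\<phi>. \<phi> \<in> C \<Longrightarrow> is_character A \<phi>"
  shows "inj_on (embed_fun f (carrier A)) C"
proof (rule inj_onI, rule ext)
  fix \<phi> \<psi> g assume C: "\<phi> \<in> C" "\<psi> \<in> C" and eq: "embed_fun f (carrier A) \<phi> = embed_fun f (carrier A) \<psi>"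
  show "\<phi> g = \<psi> g"
  proof (cases "g \<in> carrier A")
    case True
    then show ?thesis using fun_cong[OF eq, of "f g"] assms(1) by (simp add: embed_fun_apply)
  next
    case False
    then show ?thesis using character_outside assms(2) C by metis
  qed
qed

lemma partition_on_image_inj:
  assumes "inj_on f A" "partition_on A P"
  shows "partition_on (f ` A) ((`) f ` P)"
proof (rule partition_onI)
  have U: "A = \<Union>P" using assms(2) by (rule partition_onD1)
  show "\<Union>((`) f ` P) = f ` A" unfolding U by auto
  show "{} \<notin> (`) f ` P" using partition_onD3[OF assms(2)] by auto
  show "disjnt X Y" if XY: "X \<in> (`) f ` P" "Y \<in> (`) f ` P" "X \<noteq> Y" for X Y
  proof -
    obtain K L where KL: "K \<in> P" "L \<in> P" "X = f ` K" "Y = f ` L" "K \<noteq> L" using XY by auto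
    then have "K \<inter> L = {}" using partition_onD2[OF assms(2)] by (auto simp: disjoint_def)
    then have "f ` K \<inter> f ` L = {}"
      using inj_on_image_Int[OF assms(1), of K L] KL U by auto
    then show ?thesis using KL by (simp add: disjnt_def)
  qed
qed

lemma embed_superclass_basis:
  assumes A: "group A" and B: "group B" and f: "f \<in> mon A B" and T: "superclass_basis A T"
  shows "superclass_basis (B\<lparr>carrier := f ` carrier A\<rparr>) (embed_theory f (carrier A) T)"
proof -
  have inj: "inj_on f (carrier A)" using f by (auto simp: mon_def)
  note part = superclass_basisD(1)[OF T]
  note ch = superclass_basisD(4)[OF T]
  have U: "K \<subseteq> carrier A" if "K \<in> scl T" for K using that partition_onD1[OF part] by auto
  \<comment> \<open>Distinct superclasses have distinct images, and likewise distinct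
    supercharacters, so the two cardinalities remain equal.\<close>
  have "inj_on ((`) f) (scl T)"
    using U by (intro inj_on_subset[OF inj_on_image_Pow[OF inj]]) auto
  then have card: "card ((`) f ` scl T) = card (embed_fun f (carrier A) ` sch T)"
    using embed_fun_inj_on[OF inj ch] superclass_basisD(3)[OF T] by (simp add: card_image)
  show ?thesis
    unfolding superclass_basis_def embed_theory_def fst_conv snd_conv
  proof (intro conjI ballI card)
    show "partition_on (carrier (B\<lparr>carrier := f ` carrier A\<rparr>)) ((`) f ` scl T)"
      using partition_on_image_inj[OF inj part] by simp
    show "finite (embed_fun f (carrier A) ` sch T)" using superclass_basisD(2)[OF T] by simp
    show "pairwise (\<lambda>chi \<zeta>. char_inner (B\<lparr>carrier := f ` carrier A\<rparr>) chi \<zeta> = 0)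
        (embed_fun f (carrier A) ` sch T)"
      unfolding pairwise_image using superclass_basisD(6)[OF T]
      by (auto simp: pairwise_def embed_char_inner[OF inj])
  next
    fix c assume "c \<in> embed_fun f (carrier A) ` sch T"
    then obtain chi where c: "c = embed_fun f (carrier A) chi" and chi: "chi \<in> sch T" by blast
    show "is_character (B\<lparr>carrier := f ` carrier A\<rparr>) c"
      unfolding c by (rule embed_character[OF A B f ch[OF chi]])
    show "c \<noteq> (\<lambda>_. 0)"
    proof
      assume "c = (\<lambda>_. 0)"
      then have "chi g = 0" for g
        using embed_fun_apply[OF inj, of g chi] character_outside[OF ch[OF chi], of g]
        by (cases "g \<in> carrier A") (auto simp: c)
      then show False using superclass_basisD(5)[OF T chi] by auto
    qed
    fix L g h assume L: "L \<in> (`) f ` scl T" "g \<in> L" "h \<in> L"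
    then obtain K x y where K: "K \<in> scl T" "x \<in> K" "y \<in> K" "g = f x" "h = f y" by blast
    then have "x \<in> carrier A" "y \<in> carrier A" using U by auto
    then show "c g = c h"
      using superclass_basisD(7)[OF T chi K(1-3)] K by (simp add: c embed_fun_apply[OF inj])
  qed
qed

section \<open>Image subgroups, the trivial bottom group and a single step of the tower\<close>

lemma image_subgroup:
  assumes "group A" "group B" "f \<in> mon A B"
  shows "subgroup (f ` carrier A) B"
  using assms by (intro group_hom.img_is_subgroup) (auto simp: group_hom_def group_hom_axioms_def mon_def)

text \<open>A partition of a one-point carrier has a single block, and there are as many
  supercharacters as superclasses.\<close>

lemma supercharacters_trivial_group:
  assumes T: "superclass_basis G T" and G: "carrier G = {e}" and chi: "chi \<in> sch T"
  shows "sch T = {chi}"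
proof -
  note part = superclass_basisD(1)[OF T, unfolded G]
  have "K = {e}" if "K \<in> scl T" for K
    using that partition_onD1[OF part] partition_onD3[OF part] by (metis Union_upper subset_singletonD)
  moreover have "scl T \<noteq> {}" using partition_onD1[OF part] by auto
  ultimately have "scl T = {{e}}" by blast
  then have "card (sch T) = 1" using superclass_basisD(3)[OF T] by simp
  then show ?thesis using chi by (auto simp: card_1_singleton_iff)
qed

text \<open>The degree of \<open>chi\<close> may exceed 1; it cancels because the scalar product of
  \<open>chi\<close> with itself is the square of the degree.\<close>

lemma SPl_trivial_group:
  assumes G: "group G" "carrier G = {\<one>\<^bsub>G\<^esub>}" and chi: "is_character G chi" "chi \<noteq> (\<lambda>_. 0)"
  shows "SPl G chi = 1"
proof -
  have "cnj (chi \<one>\<^bsub>G\<^esub>) = chi \<one>\<^bsub>G\<^esub>"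
    using character_one_nonneg[OF G(1) chi(1)]
    by (metis Reals_cnj_iff nonneg_Reals_subset_Reals subsetD)
  then show ?thesis
    using character_one_nonzero[OF G(1) chi] G(2)
    by (simp add: SPl_def char_inner_def power2_eq_square)
qed

text \<open>The results for subgroups, applied to the image of \<open>emb n\<close>. In the last
  formula the sum over embedded supercharacters is pulled back along \<open>embed_fun\<close>, and
  the factors are ordered as in \<open>markov_process_marginal_Suc\<close>.\<close>

lemma tower_transition_props:
  assumes G: "\<And>n. group (\<Gamma> n)" "\<And>n. finite (carrier (\<Gamma> n))"
    and emb: "\<And>n. emb n \<in> mon (\<Gamma> n) (\<Gamma> (Suc n))"
    and T: "\<And>n. supercharacter_theory (\<Gamma> n) (T n)"
  shows "\<gamma> \<in> sch (T n) \<Longrightarrow> chi \<in> sch (T (Suc n)) \<Longrightarrow> tower_transition \<Gamma> emb T n \<gamma> chi \<in> \<real>\<^sub>\<ge>\<^sub>0"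
    and "\<gamma> \<in> sch (T n) \<Longrightarrow> (\<Sum>chi\<in>sch (T (Suc n)). tower_transition \<Gamma> emb T n \<gamma> chi) = 1"
    and "consistent (embed_theory (emb n) (carrier (\<Gamma> n)) (T n)) (T (Suc n)) \<Longrightarrow> chi \<in> sch (T (Suc n)) \<Longrightarrow>
      (\<Sum>\<gamma>\<in>sch (T n). SPl (\<Gamma> n) \<gamma> * tower_transition \<Gamma> emb T n \<gamma> chi) = SPl (\<Gamma> (Suc n)) chi"
proof -
  let ?f = "embed_fun (emb n) (carrier (\<Gamma> n))"
  note B = supercharacter_theory_basis[OF T]
  note E = embed_superclass_basis[OF G(1) G(1) emb B, of n]
  note sub = image_subgroup[OF G(1) G(1) emb, of n]
  have sch: "sch (embed_theory (emb n) (carrier (\<Gamma> n)) (T n)) = ?f ` sch (T n)"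
    by (simp add: embed_theory_def)
  have inj: "inj_on ?f (sch (T n))"
    using emb[of n] superclass_basisD(4)[OF B[of n]] by (intro embed_fun_inj_on) (auto simp: mon_def)
  show "tower_transition \<Gamma> emb T n \<gamma> chi \<in> \<real>\<^sub>\<ge>\<^sub>0" if "\<gamma> \<in> sch (T n)" "chi \<in> sch (T (Suc n))"
    unfolding tower_transition_def
    using superclass_basisD(4)[OF E] that sch by (intro transition_nonneg[OF G sub B]) auto
  show "(\<Sum>chi\<in>sch (T (Suc n)). tower_transition \<Gamma> emb T n \<gamma> chi) = 1" if "\<gamma> \<in> sch (T n)"
    unfolding tower_transition_def
    using superclass_basisD(4,5)[OF E] that sch by (intro sum_transition_eq_1[OF G sub T]) blast+
  show "(\<Sum>\<gamma>\<in>sch (T n). SPl (\<Gamma> n) \<gamma> * tower_transition \<Gamma> emb T n \<gamma> chi) = SPl (\<Gamma> (Suc n)) chi"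
    if con: "consistent (embed_theory (emb n) (carrier (\<Gamma> n)) (T n)) (T (Suc n))" and chi: "chi \<in> sch (T (Suc n))"
    using sum_transition_SPl[OF G sub B E con chi]
    by (simp add: sch sum.reindex[OF inj] embed_SPl[OF G(1) G(1) emb] tower_transition_def mult.commute)
qed

text \<open>Existence is claimed on the space of trajectories, while the marginals are determined
  for every process with this initial state and these transitions, on an arbitrary sample space
  \<open>'w\<close>.\<close>

theorem proposition2p10:
  fixes G :: "('a, 'c) monoid_scheme" and H :: "'a set" and TG TH :: "'a sct"
    and \<Gamma> :: "nat \<Rightarrow> ('b, 'd) monoid_scheme" and emb :: "nat \<Rightarrow> 'b \<Rightarrow> 'b" and T :: "nat \<Rightarrow> 'b sct"
    and chi1 :: "'b \<Rightarrow> complex"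
  shows
    "(group G \<and> finite (carrier G) \<and> subgroup H G \<and>
      supercharacter_theory G TG \<and> supercharacter_theory (G\<lparr>carrier := H\<rparr>) TH \<and>
      consistent TH TG \<longrightarrow>
        (\<forall>chi\<in>sch TG. (\<Sum>\<gamma>\<in>sch TH. transition G H TG \<gamma> chi * SPl (G\<lparr>carrier := H\<rparr>) \<gamma>) = SPl G chi) \<and>
        (\<forall>\<gamma>\<in>sch TH. (\<Sum>chi\<in>sch TG. transition G H TG \<gamma> chi) = 1)) \<and>
     ((\<forall>n. group (\<Gamma> n) \<and> finite (carrier (\<Gamma> n))) \<and> carrier (\<Gamma> 0) = {\<one>\<^bsub>\<Gamma> 0\<^esub>} \<and>
      (\<forall>n. emb n \<in> mon (\<Gamma> n) (\<Gamma> (Suc n))) \<and>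
      (\<forall>n. supercharacter_theory (\<Gamma> n) (T n)) \<and>
      (\<forall>n. consistent (embed_theory (emb n) (carrier (\<Gamma> n)) (T n)) (T (Suc n))) \<and>
      chi1 \<in> sch (T 0) \<longrightarrow>
        sch (T 0) = {chi1} \<and>
        (\<exists>(M :: (nat \<Rightarrow> 'b \<Rightarrow> complex) measure) Y.
           markov_process M Y (\<lambda>n. sch (T n)) chi1 (tower_transition \<Gamma> emb T)) \<and>
        (\<forall>(M :: 'w measure) Y.
           markov_process M Y (\<lambda>n. sch (T n)) chi1 (tower_transition \<Gamma> emb T) \<longrightarrow>
           (\<forall>n. \<forall>chi\<in>sch (T n).
              complex_of_real (\<P>(\<omega> in M. Y n \<omega> = chi)) = SPl (\<Gamma> n) chi)))"
proof (intro conjI impI ballI allI)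
  assume a: "group G \<and> finite (carrier G) \<and> subgroup H G \<and>
      supercharacter_theory G TG \<and> supercharacter_theory (G\<lparr>carrier := H\<rparr>) TH \<and>
      consistent TH TG"
  then have TG: "superclass_basis G TG" and TH: "superclass_basis (G\<lparr>carrier := H\<rparr>) TH"
    by (auto intro: supercharacter_theory_basis)
  show "(\<Sum>\<gamma>\<in>sch TH. transition G H TG \<gamma> chi * SPl (G\<lparr>carrier := H\<rparr>) \<gamma>) = SPl G chi"
    if "chi \<in> sch TG" for chi
    using a by (intro sum_transition_SPl[OF _ _ _ TG TH _ that]) auto
  show "(\<Sum>chi\<in>sch TG. transition G H TG \<gamma> chi) = 1" if "\<gamma> \<in> sch TH" for \<gamma>
    using a superclass_basisD(4,5)[OF TH that] by (intro sum_transition_eq_1) auto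
next
  assume a: "(\<forall>n. group (\<Gamma> n) \<and> finite (carrier (\<Gamma> n))) \<and> carrier (\<Gamma> 0) = {\<one>\<^bsub>\<Gamma> 0\<^esub>} \<and>
      (\<forall>n. emb n \<in> mon (\<Gamma> n) (\<Gamma> (Suc n))) \<and>
      (\<forall>n. supercharacter_theory (\<Gamma> n) (T n)) \<and>
      (\<forall>n. consistent (embed_theory (emb n) (carrier (\<Gamma> n)) (T n)) (T (Suc n))) \<and>
      chi1 \<in> sch (T 0)"
  then have G: "\<And>n. group (\<Gamma> n)" "\<And>n. finite (carrier (\<Gamma> n))"
    and emb: "\<And>n. emb n \<in> mon (\<Gamma> n) (\<Gamma> (Suc n))"
    and T: "\<And>n. supercharacter_theory (\<Gamma> n) (T n)"
    and con: "\<And>n. consistent (embed_theory (emb n) (carrier (\<Gamma> n)) (T n)) (T (Suc n))"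
    and triv: "carrier (\<Gamma> 0) = {\<one>\<^bsub>\<Gamma> 0\<^esub>}" and chi1: "chi1 \<in> sch (T 0)" by auto
  note B = supercharacter_theory_basis[OF T]
  note props = tower_transition_props[of \<Gamma> emb T, OF G emb T]
  have fin: "finite (sch (T n))" for n using superclass_basisD(2)[OF B] .
  show sch0: "sch (T 0) = {chi1}" by (rule supercharacters_trivial_group[OF B triv chi1])
  show "\<exists>(M :: (nat \<Rightarrow> 'b \<Rightarrow> complex) measure) Y.
      markov_process M Y (\<lambda>n. sch (T n)) chi1 (tower_transition \<Gamma> emb T)"
    by (rule markov_process_exists[of "\<lambda>n. sch (T n)"]) (use fin chi1 props(1,2) in auto)
  fix M :: "'w measure" and Y n chi
  assume mp: "markov_process M Y (\<lambda>n. sch (T n)) chi1 (tower_transition \<Gamma> emb T)"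
  then interpret prob_space M by (simp add: markov_process_def)
  \<comment> \<open>The induction hypothesis is needed for all supercharacters of level
    \<open>n\<close> at once, since the next marginal sums over them.\<close>
  have "\<forall>chi\<in>sch (T n). complex_of_real (\<P>(\<omega> in M. Y n \<omega> = chi)) = SPl (\<Gamma> n) chi"
  proof (induction n)
    case 0
    \<comment> \<open>The state space at time 0 has only one point, so measurability alone places
      \<open>Y 0\<close> there on the whole sample space.\<close>
    have "{\<omega> \<in> space M. Y 0 \<omega> = chi1} = space M"
    proof -
      have "Y 0 \<in> measurable M (count_space (sch (T 0)))" using mp unfolding markov_process_def by blast
      from measurable_space[OF this] show ?thesis by (auto simp: sch0)
    qed
    then have "\<P>(\<omega> in M. Y 0 \<omega> = chi1) = 1" using prob_space by simp
    moreover have "SPl (\<Gamma> 0) chi1 = 1"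
      using superclass_basisD(4,5)[OF B chi1] by (intro SPl_trivial_group[OF G(1) triv]) auto
    ultimately show ?case by (simp add: sch0)
  next
    case (Suc n)
    show ?case
    proof
      fix chi assume chi: "chi \<in> sch (T (Suc n))"
      have "complex_of_real (\<P>(\<omega> in M. Y (Suc n) \<omega> = chi)) =
          (\<Sum>\<gamma>\<in>sch (T n). complex_of_real (\<P>(\<omega> in M. Y n \<omega> = \<gamma>)) * tower_transition \<Gamma> emb T n \<gamma> chi)"
        by (rule markov_process_marginal_Suc[OF mp fin chi])
      also have "\<dots> = (\<Sum>\<gamma>\<in>sch (T n). SPl (\<Gamma> n) \<gamma> * tower_transition \<Gamma> emb T n \<gamma> chi)"
        using Suc.IH by (intro sum.cong) auto
      also have "\<dots> = SPl (\<Gamma> (Suc n)) chi" by (rule props(3)[OF con chi])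
      finally show "complex_of_real (\<P>(\<omega> in M. Y (Suc n) \<omega> = chi)) = SPl (\<Gamma> (Suc n)) chi" .
    qed
  qed
  then show "chi \<in> sch (T n) \<Longrightarrow> complex_of_real (\<P>(\<omega> in M. Y n \<omega> = chi)) = SPl (\<Gamma> n) chi" by blast
qed

end
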